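(* Let $H$ be a Hopf algebra over a field $k$ with adjoint map $\mathrm{ad}$, and let $D_2$ and $D_3=d^{3,1}+d^{3,2}+d^{3,3}$ be the second and third adjoint differentials. Then $D_3 D_2=0$; that is, for every $\phi\in \mathrm{Hom}(H^{\otimes 2},H)$, setting $(\xi_1,\xi_2)=D_2(\phi)$, one has $d^{3,1}(\xi_1,\xi_2)=0$, $d^{3,2}(\xi_1,\xi_2)=0$ and $d^{3,3}(\xi_1,\xi_2)=0$.
   Context: $H$ is a Hopf algebra over a field $k$ with multiplication $\mu$, comultiplication $\Delta$, antipode $S$; Sweedler notation $\Delta(y)=y_{(1)}\otimes y_{(2)}$; $\tau(x\otimes y)=y\otimes x$; inside formulas for maps $1$ denotes the identity of $H$ and $1^m$ the identity of $H^{\otimes m}$. All Hom's are spaces of $k$-linear maps. Adjoint map: $\mathrm{ad}(x\otimes y)=S(y_{(1)})\,x\,y_{(2)}$. Induced $R$-matrix: $R_{\mathrm{ad}}=(1\otimes\mathrm{ad})(\tau\otimes 1)(1\otimes\Delta):H\otimes H\to H\otimes H$. Cochain groups: $C^2_{\mathrm{ad}}(H;H)=\mathrm{Hom}(H^{\otimes 2},H)$, $C^3_{\mathrm{ad}}(H;H)=\mathrm{Hom}(H^{\otimes 3},H)\oplus\mathrm{Hom}(H^{\otimes 2},H^{\otimes 2})$; the target of $D_3$ is $\mathrm{Hom}(H^{\otimes 4},H)\oplus\mathrm{Hom}(H^{\otimes 3},H^{\otimes 2})\oplus\mathrm{Hom}(H^{\otimes 2},H^{\otimes 3})$. Second differential: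 $D_2(\phi)=(d^{2,1}(\phi),d^{2,2}(\phi))$ with $d^{2,1}(\phi)=\mathrm{ad}(\phi\otimes 1)+\phi(\mathrm{ad}\otimes 1)-\phi(1\otimes\mu)$, $d^{2,2}(\phi)=(\phi\otimes\mu)(1\otimes\tau\otimes 1)(\Delta\otimes\Delta)-(1\otimes\mu)(\tau\otimes 1)(1\otimes\Delta)(1\otimes\phi)(\tau\otimes 1)(1\otimes\Delta)$. Third differential: for $\xi_1\in\mathrm{Hom}(H^{\otimes 3},H)$, $\xi_2\in\mathrm{Hom}(H^{\otimes 2},H^{\otimes 2})$, $D_3(\xi_1,\xi_2)$ has components $d^{3,1}(\xi_1,\xi_2)=\mathrm{ad}(\xi_1\otimes 1)+\xi_1(1\otimes\mu\otimes 1)-\xi_1(\mathrm{ad}\otimes 1^2+1^2\otimes\mu)$, $d^{3,2}(\xi_1,\xi_2)=(\mathrm{ad}\otimes\mu)(1\otimes\tau\otimes 1)(1^2\otimes\Delta)(\xi_2\otimes 1)+(1\otimes\mu)(\tau\otimes 1)(1\otimes\xi_2)(R_{\mathrm{ad}}\otimes 1)$ $\quad+(1\otimes\mu)(1^2\otimes\mu)(\tau\otimes 1^2)(1\otimes\tau\otimes 1)(1^2\otimes\Delta)(1^2\otimes\xi_1)(1\otimes\tau\otimes 1^2)(\tau\otimes 1^3)(1^2\otimes\tau\otimes 1)(1\otimes\Delta\otimes\Delta)$ $\quad-(\xi_1\otimes\mu)(1^2\otimes\tau\otimes 1)(1^2\otimes\mu\otimes 1^2)(1\otimes\tau\otimes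 1^3)(\Delta\otimes\Delta\otimes\Delta)-\xi_2(1\otimes\mu)$, $d^{3,3}(\xi_1,\xi_2)=(1\otimes\mu\otimes 1)(\tau\otimes 1^2)(1\otimes\Delta\otimes 1)(1\otimes\xi_2)(\tau\otimes 1)(1\otimes\Delta)+(\xi_2\otimes\mu)(1\otimes\tau\otimes 1)(\Delta\otimes\Delta)-(1\otimes\Delta)\xi_2$. *)

theory Defs
  imports Complex_Main "HOL-Library.Poly_Mapping"
begin

text \<open>Elements of \<open>'x \<Rightarrow>\<^sub>0 'k\<close> are formal linear combinations of elements of \<open>'x\<close>.\<close>

definition fscale :: "'k::field \<Rightarrow> ('x \<Rightarrow>\<^sub>0 'k) \<Rightarrow> ('x \<Rightarrow>\<^sub>0 'k)" where
  "fscale c p = Poly_Mapping.map ((*) c) p"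

lemma lookup_fscale: "Poly_Mapping.lookup (fscale c p) x = c * Poly_Mapping.lookup p x"
  by (simp add: fscale_def map.rep_eq when_def)

interpretation formal: vector_space "fscale :: 'k::field \<Rightarrow> ('x \<Rightarrow>\<^sub>0 'k) \<Rightarrow> ('x \<Rightarrow>\<^sub>0 'k)"
  by unfold_locales
    (auto intro!: poly_mapping_eqI simp: lookup_fscale lookup_add algebra_simps)

text \<open>The bilinear extension of concatenation of words.\<close>

definition fconcat :: "('a list \<Rightarrow>\<^sub>0 'k::field) \<Rightarrow> ('a list \<Rightarrow>\<^sub>0 'k) \<Rightarrow> ('a list \<Rightarrow>\<^sub>0 'k)" where
  "fconcat p q = (\<Sum>xs\<in>Poly_Mapping.keys p. \<Sum>ys\<in>Poly_Mapping.keys q.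
     Poly_Mapping.single (xs @ ys) (Poly_Mapping.lookup p xs * Poly_Mapping.lookup q ys))"

text \<open>Let \<open>H\<close> be the vector space carried by the type \<open>'a\<close>.  A tensor is a coset, in the free
  vector space on all words over \<open>H\<close>, of the subspace spanned by the multilinearity relations.
  These relations only relate words of equal length, so the cosets of combinations of
  words of length \<open>n\<close> form the usual quotient \<open>H\<^sup>\<otimes>\<^sup>n\<close>, and all tensor powers live in one type.
  In particular \<open>H\<^sup>\<otimes>\<^sup>0\<close> is the ground field, spanned by the empty word, and \<open>H\<close> is
  identified with \<open>H\<^sup>\<otimes>\<^sup>1\<close> by sending \<open>x\<close> to the class of the word \<open>[x]\<close>; the identifications
  \<open>H\<^sup>\<otimes>\<^sup>m \<otimes> H\<^sup>\<otimes>\<^sup>n = H\<^sup>\<otimes>\<^sup>(\<^sup>m\<^sup>+\<^sup>n\<^sup>)\<close> are strict.\<close>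

type_synonym ('a, 'k) tensor = "('a list \<Rightarrow>\<^sub>0 'k) set"

locale tensor_powers = vector_space scale
  for scale :: "'k::field \<Rightarrow> 'a::ab_group_add \<Rightarrow> 'a" (infixr \<open>*s\<close> 75)
begin

definition relations :: "('a list \<Rightarrow>\<^sub>0 'k) set" where
  "relations =
     {Poly_Mapping.single (us @ [x + y] @ vs) 1 - Poly_Mapping.single (us @ [x] @ vs) 1
        - Poly_Mapping.single (us @ [y] @ vs) 1 | us vs x y. True}
   \<union> {Poly_Mapping.single (us @ [c *s x] @ vs) 1 - fscale c (Poly_Mapping.single (us @ [x] @ vs) 1)
        | us vs c x. True}"

definition relation_span :: "('a list \<Rightarrow>\<^sub>0 'k) set" where
  "relation_span = formal.span relations"

definition cls :: "('a list \<Rightarrow>\<^sub>0 'k) \<Rightarrow> ('a, 'k) tensor" where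
  "cls p = {q. q - p \<in> relation_span}"

definition T :: "nat \<Rightarrow> ('a, 'k) tensor set" where
  "T n = {cls p | p. \<forall>xs\<in>Poly_Mapping.keys p. length xs = n}"

text \<open>The elementary tensor \<open>x\<^sub>1 \<otimes> \<dots> \<otimes> x\<^sub>n\<close> of a list.\<close>

definition pure :: "'a list \<Rightarrow> ('a, 'k) tensor" where
  "pure xs = cls (Poly_Mapping.single xs 1)"

text \<open>The operations induced on cosets by operations on representatives (on cosets,
  each of these unions is a union of equal sets).\<close>

definition tzero :: "('a, 'k) tensor" where
  "tzero = cls 0"

definition tadd :: "('a, 'k) tensor \<Rightarrow> ('a, 'k) tensor \<Rightarrow> ('a, 'k) tensor" where
  "tadd u v = (\<Union>p\<in>u. \<Union>q\<in>v. cls (p + q))"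

definition tdiff :: "('a, 'k) tensor \<Rightarrow> ('a, 'k) tensor \<Rightarrow> ('a, 'k) tensor" where
  "tdiff u v = (\<Union>p\<in>u. \<Union>q\<in>v. cls (p - q))"

definition tscale :: "'k \<Rightarrow> ('a, 'k) tensor \<Rightarrow> ('a, 'k) tensor" where
  "tscale c u = (\<Union>p\<in>u. cls (fscale c p))"

definition tmul :: "('a, 'k) tensor \<Rightarrow> ('a, 'k) tensor \<Rightarrow> ('a, 'k) tensor" where
  "tmul u v = (\<Union>p\<in>u. \<Union>q\<in>v. cls (fconcat p q))"

text \<open>Maps are functions on all of \<open>('a, 'k) tensor\<close>; only their values on the tensor power that
  is their domain are relevant, and two maps on \<open>H\<^sup>\<otimes>\<^sup>n\<close> count as equal if they agree on \<open>T n\<close>.\<close>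

definition linear_on :: "nat \<Rightarrow> (('a, 'k) tensor \<Rightarrow> ('a, 'k) tensor) \<Rightarrow> bool" where
  "linear_on n f \<longleftrightarrow>
     (\<forall>u\<in>T n. f u \<in> range cls) \<and>
     (\<forall>u\<in>T n. \<forall>v\<in>T n. f (tadd u v) = tadd (f u) (f v)) \<and>
     (\<forall>c. \<forall>u\<in>T n. f (tscale c u) = tscale c (f u))"

definition Hom :: "nat \<Rightarrow> nat \<Rightarrow> (('a, 'k) tensor \<Rightarrow> ('a, 'k) tensor) set" where
  "Hom n m = {f. linear_on n f \<and> (\<forall>u\<in>T n. f u \<in> T m)}"

text \<open>The linear map on \<open>H\<^sup>\<otimes>\<^sup>n\<close> with prescribed values on elementary tensors; it exists and is
  unique on \<open>T n\<close> when \<open>F\<close> is multilinear on lists of length \<open>n\<close>.\<close>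

definition lift :: "nat \<Rightarrow> ('a list \<Rightarrow> ('a, 'k) tensor) \<Rightarrow> ('a, 'k) tensor \<Rightarrow> ('a, 'k) tensor" where
  "lift n F = (SOME f. linear_on n f \<and> (\<forall>xs. length xs = n \<longrightarrow> f (pure xs) = F xs))"

text \<open>The tensor product of a map on \<open>H\<^sup>\<otimes>\<^sup>m\<close> and a map on \<open>H\<^sup>\<otimes>\<^sup>n\<close>; the subscripts are the degrees of
  the two domains.\<close>

definition tens ::
  "(('a, 'k) tensor \<Rightarrow> ('a, 'k) tensor) \<Rightarrow> nat \<Rightarrow> nat \<Rightarrow> (('a, 'k) tensor \<Rightarrow> ('a, 'k) tensor)
     \<Rightarrow> ('a, 'k) tensor \<Rightarrow> ('a, 'k) tensor"
  (\<open>_ \<otimes>\<^bsub>_,_\<^esub> _\<close> [76, 0, 0, 75] 75) where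
  "f \<otimes>\<^bsub>m,n\<^esub> g = lift (m + n) (\<lambda>xs. tmul (f (pure (take m xs))) (g (pure (drop m xs))))"

definition \<tau> :: "('a, 'k) tensor \<Rightarrow> ('a, 'k) tensor" where
  "\<tau> = lift 2 (\<lambda>xs. pure [xs ! 1, xs ! 0])"

definition hadd (infixl \<open>\<boxplus>\<close> 52) where
  "f \<boxplus> g = (\<lambda>u :: ('a, 'k) tensor. tadd (f u) (g u))"

definition hdiff (infixl \<open>\<boxminus>\<close> 52) where
  "f \<boxminus> g = (\<lambda>u :: ('a, 'k) tensor. tdiff (f u) (g u))"

end

text \<open>Multiplication and unit are those of the ring type \<open>'a\<close>.\<close>

locale hopf_data = tensor_powers scale
  for scale :: "'k::field \<Rightarrow> 'a::ring_1 \<Rightarrow> 'a" (infixr \<open>*s\<close> 75) +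
  fixes comult :: "'a \<Rightarrow> ('a, 'k) tensor"
    and counit :: "'a \<Rightarrow> 'k"
    and antipode :: "'a \<Rightarrow> 'a"
begin

definition \<mu> :: "('a, 'k) tensor \<Rightarrow> ('a, 'k) tensor" where
  "\<mu> = lift 2 (\<lambda>xs. pure [xs ! 0 * xs ! 1])"

definition \<Delta> :: "('a, 'k) tensor \<Rightarrow> ('a, 'k) tensor" where
  "\<Delta> = lift 1 (\<lambda>xs. comult (xs ! 0))"

definition \<epsilon> :: "('a, 'k) tensor \<Rightarrow> ('a, 'k) tensor" where
  "\<epsilon> = lift 1 (\<lambda>xs. tscale (counit (xs ! 0)) (pure []))"

definition S :: "('a, 'k) tensor \<Rightarrow> ('a, 'k) tensor" where
  "S = lift 1 (\<lambda>xs. pure [antipode (xs ! 0)])"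

end

locale hopf_algebra = hopf_data scale comult counit antipode
  for scale :: "'k::field \<Rightarrow> 'a::ring_1 \<Rightarrow> 'a" (infixr \<open>*s\<close> 75)
    and comult :: "'a \<Rightarrow> ('a, 'k) tensor"
    and counit :: "'a \<Rightarrow> 'k"
    and antipode :: "'a \<Rightarrow> 'a" +
  assumes scale_mult_left: "(c *s x) * y = c *s (x * y)"
    and scale_mult_right: "x * (c *s y) = c *s (x * y)"
    and comult_closed: "comult x \<in> T 2"
    and comult_add: "comult (x + y) = tadd (comult x) (comult y)"
    and comult_scale: "comult (c *s x) = tscale c (comult x)"
    and counit_linear: "Vector_Spaces.linear scale (*) counit"
    and antipode_linear: "Vector_Spaces.linear scale scale antipode"
    and coassoc: "(\<Delta> \<otimes>\<^bsub>1,1\<^esub> id) (comult x) = (id \<otimes>\<^bsub>1,1\<^esub> \<Delta>) (comult x)"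
    and counit_left: "(\<epsilon> \<otimes>\<^bsub>1,1\<^esub> id) (comult x) = pure [x]"
    and counit_right: "(id \<otimes>\<^bsub>1,1\<^esub> \<epsilon>) (comult x) = pure [x]"
    and comult_mult:
      "comult (x * y) = ((\<mu> \<otimes>\<^bsub>2,2\<^esub> \<mu>) \<circ> (id \<otimes>\<^bsub>1,3\<^esub> \<tau> \<otimes>\<^bsub>2,1\<^esub> id)) (tmul (comult x) (comult y))"
    and comult_one: "comult 1 = pure [1, 1]"
    and counit_mult: "counit (x * y) = counit x * counit y"
    and counit_one: "counit 1 = 1"
    and antipode_left: "(\<mu> \<circ> (S \<otimes>\<^bsub>1,1\<^esub> id)) (comult x) = pure [counit x *s 1]"
    and antipode_right: "(\<mu> \<circ> (id \<otimes>\<^bsub>1,1\<^esub> S)) (comult x) = pure [counit x *s 1]"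
begin

text \<open>\<open>ad (x \<otimes> y) = S y\<^sub>(\<^sub>1\<^sub>) x y\<^sub>(\<^sub>2\<^sub>)\<close>; the inner map is applied to \<open>y\<^sub>(\<^sub>1\<^sub>) \<otimes> y\<^sub>(\<^sub>2\<^sub>)\<close>.\<close>

definition ad :: "('a, 'k) tensor \<Rightarrow> ('a, 'k) tensor" where
  "ad = lift 2 (\<lambda>xs. lift 2 (\<lambda>ys. pure [antipode (ys ! 0) * xs ! 0 * ys ! 1]) (comult (xs ! 1)))"

definition R_ad :: "('a, 'k) tensor \<Rightarrow> ('a, 'k) tensor" where
  "R_ad = (id \<otimes>\<^bsub>1,2\<^esub> ad) \<circ> (\<tau> \<otimes>\<^bsub>2,1\<^esub> id) \<circ> (id \<otimes>\<^bsub>1,1\<^esub> \<Delta>)"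

definition d21 where
  "d21 \<phi> = (ad \<circ> (\<phi> \<otimes>\<^bsub>2,1\<^esub> id) \<boxplus> \<phi> \<circ> (ad \<otimes>\<^bsub>2,1\<^esub> id) \<boxminus> \<phi> \<circ> (id \<otimes>\<^bsub>1,2\<^esub> \<mu>))"

definition d22 where
  "d22 \<phi> =
    ((\<phi> \<otimes>\<^bsub>2,2\<^esub> \<mu>) \<circ> (id \<otimes>\<^bsub>1,3\<^esub> \<tau> \<otimes>\<^bsub>2,1\<^esub> id) \<circ> (\<Delta> \<otimes>\<^bsub>1,1\<^esub> \<Delta>)
     \<boxminus> (id \<otimes>\<^bsub>1,2\<^esub> \<mu>) \<circ> (\<tau> \<otimes>\<^bsub>2,1\<^esub> id) \<circ> (id \<otimes>\<^bsub>1,1\<^esub> \<Delta>) \<circ> (id \<otimes>\<^bsub>1,2\<^esub> \<phi>) \<circ> (\<tau> \<otimes>\<^bsub>2,1\<^esub> id)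
       \<circ> (id \<otimes>\<^bsub>1,1\<^esub> \<Delta>))"

definition D2 where
  "D2 \<phi> = (d21 \<phi>, d22 \<phi>)"

definition d31 where
  "d31 \<xi>1 (\<xi>2 :: ('a, 'k) tensor \<Rightarrow> ('a, 'k) tensor) =
    (ad \<circ> (\<xi>1 \<otimes>\<^bsub>3,1\<^esub> id) \<boxplus> \<xi>1 \<circ> (id \<otimes>\<^bsub>1,3\<^esub> \<mu> \<otimes>\<^bsub>2,1\<^esub> id)
     \<boxminus> \<xi>1 \<circ> ((ad \<otimes>\<^bsub>2,2\<^esub> id) \<boxplus> (id \<otimes>\<^bsub>2,2\<^esub> \<mu>)))"

definition d32 where
  "d32 \<xi>1 \<xi>2 =
    ((ad \<otimes>\<^bsub>2,2\<^esub> \<mu>) \<circ> (id \<otimes>\<^bsub>1,3\<^esub> \<tau> \<otimes>\<^bsub>2,1\<^esub> id) \<circ> (id \<otimes>\<^bsub>2,1\<^esub> \<Delta>) \<circ> (\<xi>2 \<otimes>\<^bsub>2,1\<^esub> id)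
     \<boxplus> (id \<otimes>\<^bsub>1,2\<^esub> \<mu>) \<circ> (\<tau> \<otimes>\<^bsub>2,1\<^esub> id) \<circ> (id \<otimes>\<^bsub>1,2\<^esub> \<xi>2) \<circ> (R_ad \<otimes>\<^bsub>2,1\<^esub> id)
     \<boxplus> (id \<otimes>\<^bsub>1,2\<^esub> \<mu>) \<circ> (id \<otimes>\<^bsub>2,2\<^esub> \<mu>) \<circ> (\<tau> \<otimes>\<^bsub>2,2\<^esub> id) \<circ> (id \<otimes>\<^bsub>1,3\<^esub> \<tau> \<otimes>\<^bsub>2,1\<^esub> id)
       \<circ> (id \<otimes>\<^bsub>2,1\<^esub> \<Delta>) \<circ> (id \<otimes>\<^bsub>2,3\<^esub> \<xi>1) \<circ> (id \<otimes>\<^bsub>1,4\<^esub> \<tau> \<otimes>\<^bsub>2,2\<^esub> id) \<circ> (\<tau> \<otimes>\<^bsub>2,3\<^esub> id)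
       \<circ> (id \<otimes>\<^bsub>2,3\<^esub> \<tau> \<otimes>\<^bsub>2,1\<^esub> id) \<circ> (id \<otimes>\<^bsub>1,2\<^esub> \<Delta> \<otimes>\<^bsub>1,1\<^esub> \<Delta>)
     \<boxminus> (\<xi>1 \<otimes>\<^bsub>3,2\<^esub> \<mu>) \<circ> (id \<otimes>\<^bsub>2,3\<^esub> \<tau> \<otimes>\<^bsub>2,1\<^esub> id) \<circ> (id \<otimes>\<^bsub>2,4\<^esub> \<mu> \<otimes>\<^bsub>2,2\<^esub> id)
       \<circ> (id \<otimes>\<^bsub>1,5\<^esub> \<tau> \<otimes>\<^bsub>2,3\<^esub> id) \<circ> (\<Delta> \<otimes>\<^bsub>1,2\<^esub> \<Delta> \<otimes>\<^bsub>1,1\<^esub> \<Delta>)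
     \<boxminus> \<xi>2 \<circ> (id \<otimes>\<^bsub>1,2\<^esub> \<mu>))"

definition d33 where
  "d33 (\<xi>1 :: ('a, 'k) tensor \<Rightarrow> ('a, 'k) tensor) \<xi>2 =
    ((id \<otimes>\<^bsub>1,3\<^esub> \<mu> \<otimes>\<^bsub>2,1\<^esub> id) \<circ> (\<tau> \<otimes>\<^bsub>2,2\<^esub> id) \<circ> (id \<otimes>\<^bsub>1,2\<^esub> \<Delta> \<otimes>\<^bsub>1,1\<^esub> id) \<circ> (id \<otimes>\<^bsub>1,2\<^esub> \<xi>2)
       \<circ> (\<tau> \<otimes>\<^bsub>2,1\<^esub> id) \<circ> (id \<otimes>\<^bsub>1,1\<^esub> \<Delta>)
     \<boxplus> (\<xi>2 \<otimes>\<^bsub>2,2\<^esub> \<mu>) \<circ> (id \<otimes>\<^bsub>1,3\<^esub> \<tau> \<otimes>\<^bsub>2,1\<^esub> id) \<circ> (\<Delta> \<otimes>\<^bsub>1,1\<^esub> \<Delta>)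
     \<boxminus> (id \<otimes>\<^bsub>1,1\<^esub> \<Delta>) \<circ> \<xi>2)"

definition D3 where
  "D3 = (\<lambda>(\<xi>1, \<xi>2). (d31 \<xi>1 \<xi>2, d32 \<xi>1 \<xi>2, d33 \<xi>1 \<xi>2))"

end

end

theory Submission
  imports Defs
begin

text \<open>Everything is linear, so it suffices to evaluate on elementary tensors in Sweedler notation.
  Write \<open>x \<lhd> y = S y\<^sub>1 x y\<^sub>2\<close>, a right action because \<open>S\<close> is antimultiplicative, and let
  \<open>f x y = \<phi> (x \<otimes> y)\<close>.  In \<open>d\<^sup>3\<^sup>1\<close> all terms then cancel in pairs, and so they do in \<open>d\<^sup>3\<^sup>3\<close> by
  coassociativity and multiplicativity of \<open>\<Delta>\<close>.  In \<open>d\<^sup>3\<^sup>2\<close> two pairs are left, which cancel by the identity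
  \<open>(p \<lhd> z\<^sub>2)\<^sub>1 \<otimes> z\<^sub>1 (p \<lhd> z\<^sub>2)\<^sub>2 = (p\<^sub>1 \<lhd> z\<^sub>1) \<otimes> p\<^sub>2 z\<^sub>2\<close>, applied once to \<open>p = f x y\<^sub>2\<close> and once to
  \<open>x \<lhd> y\<^sub>2\<close> and \<open>y\<^sub>1\<close> in place of \<open>p \<lhd> z\<^sub>2\<close> and \<open>z\<^sub>1\<close>.\<close>

section \<open>Formal linear combinations\<close>

text \<open>Among arbitrary sets of formal combinations only the cosets form a vector space, so the
  type of tensors carries no library sums or linear maps; equations between tensors are therefore
  compared in the space of formal combinations, where terms can be reordered and cancelled. Sweedler
  notation becomes a finite sum over a chosen representative of the comultiplication. Such a sum has
  a meaning independent of the choice only if the summand is multilinear, for then it factors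
  through the tensor power. This is why the laws that transform Sweedler sums have premises on
  bilinearity or trilinearity. The identity that settles the second component is the compatibility
  condition of a right-right Yetter-Drinfeld module: H with the right adjoint action, and with its
  own comultiplication as right coaction, is such a module.\<close>

text \<open>The scalar multiplication \<open>s\<close> of the target is an argument because targets
  of both kinds occur: spaces of formal combinations and \<open>'a\<close> itself.\<close>

definition fext :: "('k::field \<Rightarrow> 'b \<Rightarrow> 'b) \<Rightarrow> ('x \<Rightarrow> 'b::ab_group_add) \<Rightarrow> ('x \<Rightarrow>\<^sub>0 'k) \<Rightarrow> 'b" where
  "fext s F p = (\<Sum>x\<in>Poly_Mapping.keys p. s (Poly_Mapping.lookup p x) (F x))"

lemma fext_superset:
  assumes "vector_space s" "finite A" "Poly_Mapping.keys p \<subseteq> A"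
  shows "fext s F p = (\<Sum>x\<in>A. s (Poly_Mapping.lookup p x) (F x))"
proof -
  interpret vector_space s by fact
  show ?thesis unfolding fext_def
    by (rule sum.mono_neutral_left) (use assms in \<open>auto simp: in_keys_iff\<close>)
qed

lemma linear_fext:
  assumes "vector_space s"
  shows "Vector_Spaces.linear fscale s (fext s F)"
proof -
  interpret W: vector_space s by fact
  have add: "fext s F (p + q) = fext s F p + fext s F q" for p q
  proof -
    let ?A = "Poly_Mapping.keys p \<union> Poly_Mapping.keys q"
    have "Poly_Mapping.keys (p + q) \<subseteq> ?A" by (rule Poly_Mapping.keys_add)
    then show ?thesis
      by (simp add: fext_superset[OF assms, of ?A] lookup_add W.scale_left_distrib sum.distrib)
  qed
  have scale: "fext s F (fscale c p) = s c (fext s F p)" for c p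
  proof -
    have "Poly_Mapping.keys (fscale c p) \<subseteq> Poly_Mapping.keys p"
      by (auto simp: in_keys_iff lookup_fscale)
    then show ?thesis
      by (simp add: fext_superset[OF assms, of "Poly_Mapping.keys p"] lookup_fscale W.scale_sum_right)
  qed
  show ?thesis
    by (intro Vector_Spaces.linear_iff[THEN iffD2] conjI allI add scale assms formal.vector_space_axioms)
qed

lemma fext_single:
  assumes "vector_space s"
  shows "fext s F (Poly_Mapping.single x 1) = F x"
proof -
  interpret vector_space s by fact
  show ?thesis by (simp add: fext_def)
qed

lemma fscale_single: "fscale c (Poly_Mapping.single x d) = Poly_Mapping.single x (c * d)"
  by (auto intro!: poly_mapping_eqI simp: lookup_fscale lookup_single when_def)

lemma sum_single: "p = (\<Sum>x\<in>Poly_Mapping.keys p. fscale (Poly_Mapping.lookup p x) (Poly_Mapping.single x 1))"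
proof (rule poly_mapping_eqI)
  fix y
  show "Poly_Mapping.lookup p y = Poly_Mapping.lookup
      (\<Sum>x\<in>Poly_Mapping.keys p. fscale (Poly_Mapping.lookup p x) (Poly_Mapping.single x 1)) y"
    by (simp add: lookup_sum lookup_fscale lookup_single when_def if_distrib[of "(*) _"] in_keys_iff
        cong: if_cong)
qed

lemma fconcat_eq_fext:
  "fconcat p q = fext fscale (\<lambda>xs. fext fscale (\<lambda>ys. Poly_Mapping.single (xs @ ys) 1) q) p"
  by (simp add: fconcat_def fext_def formal.scale_sum_right fscale_single)

lemma linear_fconcat_left: "Vector_Spaces.linear fscale fscale (\<lambda>p. fconcat p q)"
  unfolding fconcat_eq_fext by (intro linear_fext formal.vector_space_axioms)

lemma linear_fconcat_right: "Vector_Spaces.linear fscale fscale (fconcat p)"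
proof -
  have "fconcat p q = fext fscale (\<lambda>ys. fext fscale (\<lambda>xs. Poly_Mapping.single (xs @ ys) 1) p) q" for q
    unfolding fconcat_eq_fext fext_def formal.scale_sum_right
    by (subst sum.swap) (simp add: fscale_single mult.commute)
  then have "fconcat p = fext fscale (\<lambda>ys. fext fscale (\<lambda>xs. Poly_Mapping.single (xs @ ys) 1) p)" by auto
  then show ?thesis by (simp add: linear_fext formal.vector_space_axioms)
qed

lemma fconcat_single:
  "fconcat (Poly_Mapping.single xs 1) (Poly_Mapping.single ys 1) = Poly_Mapping.single (xs @ ys) 1"
  by (simp add: fconcat_eq_fext fext_single formal.vector_space_axioms)

text \<open>These rules take the linearity of the map as a premise, so that no locale has to be
  interpreted for each map.\<close>

lemmas lin_add = Vector_Spaces.linear_iff[THEN iffD1, THEN conjunct2, THEN conjunct2, THEN conjunct1, rule_format]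
lemmas lin_scale = Vector_Spaces.linear_iff[THEN iffD1, THEN conjunct2, THEN conjunct2, THEN conjunct2, rule_format]

lemma lin_0: "Vector_Spaces.linear s t f \<Longrightarrow> f 0 = 0"
  using lin_add[of s t f 0 0] by simp

lemma lin_diff: "Vector_Spaces.linear s t f \<Longrightarrow> f (x - y) = f x - f y"
  using lin_add[of s t f "x - y" y] by (simp add: algebra_simps)

lemma lin_sum: "Vector_Spaces.linear s t f \<Longrightarrow> f (\<Sum>i\<in>A. g i) = (\<Sum>i\<in>A. f (g i))"
  by (induction A rule: infinite_finite_induct) (simp_all add: lin_0 lin_add)

lemma lin_vanish_span:
  assumes "Vector_Spaces.linear fscale t f" "\<And>p. p \<in> B \<Longrightarrow> f p = 0" "p \<in> formal.span B"
  shows "f p = 0"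
proof -
  interpret W: vector_space t using assms(1) by (simp add: Vector_Spaces.linear_iff)
  show ?thesis using assms(3)
  proof (induction rule: formal.span_induct)
    case base
    show ?case unfolding formal.subspace_def
      by (simp add: lin_add[OF assms(1)] lin_scale[OF assms(1)] lin_0[OF assms(1)])
  qed (use assms(2) in simp)
qed

text \<open>A basis \<open>C\<close> of \<open>B\<close> is extended to a basis \<open>E\<close> of
  the whole space; \<open>g\<close> kills \<open>C\<close> and fixes the rest of \<open>E\<close>.
  On basis vectors \<open>g x - x\<close> is \<open>- x\<close> with \<open>x\<close> in
  \<open>B\<close>, or zero, so it lies in \<open>B\<close> throughout.\<close>

lemma ex_projection:
  fixes B :: "('x \<Rightarrow>\<^sub>0 'k::field) set"
  assumes "formal.subspace B"
  shows "\<exists>g. Vector_Spaces.linear fscale fscale g \<and> (\<forall>p. g p - p \<in> B) \<and> (\<forall>p\<in>B. g p = 0)"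
proof -
  interpret P: vector_space_pair "fscale :: 'k \<Rightarrow> ('x \<Rightarrow>\<^sub>0 'k) \<Rightarrow> _" "fscale :: 'k \<Rightarrow> ('x \<Rightarrow>\<^sub>0 'k) \<Rightarrow> _" ..
  obtain C where C: "C \<subseteq> B" "formal.independent C" "B \<subseteq> formal.span C"
    by (rule formal.maximal_independent_subset)
  define E where "E = formal.extend_basis C"
  have E: "formal.independent E" "formal.span E = UNIV"
    using formal.independent_extend_basis formal.span_extend_basis C(2) E_def by auto
  obtain g where g: "Vector_Spaces.linear fscale fscale g" "\<forall>x\<in>E. g x = (if x \<in> C then 0 else x)"
    using P.linear_independent_extend[OF E(1), of "\<lambda>x. if x \<in> C then 0 else x"] by blast
  have CE: "C \<subseteq> E" using formal.extend_basis_superset C(2) E_def by auto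
  have 0: "g p = 0" if "p \<in> B" for p
    by (rule lin_vanish_span[OF g(1), of C]) (use g CE C that in auto)
  have "g p - p \<in> B" for p
  proof -
    have "p \<in> formal.span E" using E by simp
    then show ?thesis
    proof (induction rule: formal.span_induct)
      case base
      have 1: "g (p + q) - (p + q) = (g p - p) + (g q - q)"
        "g (fscale c p) - fscale c p = fscale c (g p - p)" for p q c
        by (simp_all add: lin_add[OF g(1)] lin_scale[OF g(1)] formal.scale_right_diff_distrib)
      show ?case using assms
        unfolding formal.subspace_def by (simp add: 1 lin_0[OF g(1)])
    next
      case (step x)
      then have "g x = 0 \<and> x \<in> C \<or> g x = x" using g(2) by metis
      then show ?case using assms C
        by (metis add.inverse_inverse diff_0 diff_self formal.subspace_0 formal.subspace_neg in_mono)
    qed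
  qed
  with g(1) 0 show ?thesis by blast
qed

lemma UN_const: "A \<noteq> {} \<Longrightarrow> (\<And>x. x \<in> A \<Longrightarrow> f x = c) \<Longrightarrow> (\<Union>x\<in>A. f x) = c"
  by auto

section \<open>Tensor powers\<close>

context tensor_powers
begin

lemma subspace_relation_span: "formal.subspace relation_span"
  by (simp add: relation_span_def)

lemma cls_eq_iff: "cls p = cls q \<longleftrightarrow> p - q \<in> relation_span"
proof
  assume "cls p = cls q"
  moreover have "p \<in> cls p" using subspace_relation_span by (simp add: cls_def formal.subspace_0)
  ultimately show "p - q \<in> relation_span" by (simp add: cls_def)
next
  assume *: "p - q \<in> relation_span"
  have "r - p \<in> relation_span \<longleftrightarrow> r - q \<in> relation_span" for r
    using formal.subspace_add[OF subspace_relation_span _ *, of "r - p"]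
      formal.subspace_diff[OF subspace_relation_span _ *, of "r - q"] by auto
  then show "cls p = cls q" by (auto simp: cls_def)
qed

lemma mem_cls_iff: "q \<in> cls p \<longleftrightarrow> cls q = cls p"
  by (simp add: cls_eq_iff) (simp add: cls_def)

lemma cls_not_empty: "cls p \<noteq> {}"
  using mem_cls_iff[of p p] by auto

text \<open>A linear projection along the relations; its range is a copy of the tensor powers inside a
  type that is a vector space, where finite sums and linear maps are available.\<close>

definition normal_form :: "('a list \<Rightarrow>\<^sub>0 'k) \<Rightarrow> ('a list \<Rightarrow>\<^sub>0 'k)" where
  "normal_form = (SOME g. Vector_Spaces.linear fscale fscale g \<and>
     (\<forall>p. g p - p \<in> relation_span) \<and> (\<forall>p\<in>relation_span. g p = 0))"

lemma linear_normal_form: "Vector_Spaces.linear fscale fscale normal_form"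
  and normal_form_diff: "normal_form p - p \<in> relation_span"
  and normal_form_0: "p \<in> relation_span \<Longrightarrow> normal_form p = 0"
  using someI_ex[OF ex_projection[OF subspace_relation_span], folded normal_form_def] by auto

definition emb :: "('a, 'k) tensor \<Rightarrow> ('a list \<Rightarrow>\<^sub>0 'k)" where
  "emb u = normal_form (SOME p. p \<in> u)"

lemma normal_form_cong: "cls p = cls q \<Longrightarrow> normal_form p = normal_form q"
  using normal_form_0[of "p - q"] by (simp add: cls_eq_iff lin_diff[OF linear_normal_form])

lemma some_cls: "cls (SOME q. q \<in> cls p) = cls p"
  using someI[of "\<lambda>q. q \<in> cls p" p] by (simp add: mem_cls_iff)

lemma emb_cls [simp]: "emb (cls p) = normal_form p"
  unfolding emb_def by (rule normal_form_cong[OF some_cls])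

lemma cls_normal_form [simp]: "cls (normal_form p) = cls p"
  by (simp add: cls_eq_iff normal_form_diff)

lemma cls_emb: "u \<in> range cls \<Longrightarrow> cls (emb u) = u"
  by auto

section \<open>Operations on cosets, computed on representatives\<close>

lemma tadd_cls [simp]: "tadd (cls p) (cls q) = cls (p + q)"
proof -
  have "cls (p' + q') = cls (p + q)" if "p' \<in> cls p" "q' \<in> cls q" for p' q'
    using formal.subspace_add[OF subspace_relation_span, of "p' - p" "q' - q"] that
    by (simp add: cls_eq_iff mem_cls_iff algebra_simps)
  then show ?thesis unfolding tadd_def by (intro UN_const cls_not_empty) auto
qed

lemma tdiff_cls [simp]: "tdiff (cls p) (cls q) = cls (p - q)"
proof -
  have "cls (p' - q') = cls (p - q)" if "p' \<in> cls p" "q' \<in> cls q" for p' q'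
    using formal.subspace_diff[OF subspace_relation_span, of "p' - p" "q' - q"] that
    by (simp add: cls_eq_iff mem_cls_iff algebra_simps)
  then show ?thesis unfolding tdiff_def by (intro UN_const cls_not_empty) auto
qed

lemma tscale_cls [simp]: "tscale c (cls p) = cls (fscale c p)"
proof -
  have "cls (fscale c p') = cls (fscale c p)" if "p' \<in> cls p" for p'
    using formal.subspace_scale[OF subspace_relation_span, of "p' - p" c] that
    by (simp add: cls_eq_iff mem_cls_iff formal.scale_right_diff_distrib)
  then show ?thesis unfolding tscale_def by (intro UN_const cls_not_empty) auto
qed

lemma relation_add: "Poly_Mapping.single (us @ (x + y) # vs) 1 - Poly_Mapping.single (us @ x # vs) 1
    - Poly_Mapping.single (us @ y # vs) 1 \<in> relation_span"
proof -
  have "Poly_Mapping.single (us @ [x + y] @ vs) 1 - Poly_Mapping.single (us @ [x] @ vs) 1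
      - Poly_Mapping.single (us @ [y] @ vs) 1 \<in> relations"
    unfolding relations_def by blast
  then show ?thesis unfolding relation_span_def by (simp add: formal.span_base)
qed

lemma relation_scale: "Poly_Mapping.single (us @ (c *s x) # vs) 1
    - fscale c (Poly_Mapping.single (us @ x # vs) 1) \<in> relation_span"
proof -
  have "Poly_Mapping.single (us @ [c *s x] @ vs) 1 - fscale c (Poly_Mapping.single (us @ [x] @ vs) 1) \<in> relations"
    unfolding relations_def by blast
  then show ?thesis unfolding relation_span_def by (simp add: formal.span_base)
qed

lemma relations_cases:
  assumes "r \<in> relations"
  obtains us x y vs where "r = Poly_Mapping.single (us @ (x + y) # vs) 1
      - Poly_Mapping.single (us @ x # vs) 1 - Poly_Mapping.single (us @ y # vs) 1"
  | us c x vs where "r = Poly_Mapping.single (us @ (c *s x) # vs) 1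
      - fscale c (Poly_Mapping.single (us @ x # vs) 1)"
  using assms unfolding relations_def by fastforce

text \<open>The relations span a two-sided ideal for concatenation: a word put before or after a
  generator only lengthens \<open>us\<close> or \<open>vs\<close> and yields another generator.
  Linearity in each argument extends this to arbitrary combinations.\<close>

lemma fconcat_relation:
  assumes "r \<in> relation_span"
  shows "fconcat r p \<in> relation_span" "fconcat p r \<in> relation_span"
proof -
  have 1: "fconcat r (Poly_Mapping.single ws 1) \<in> relation_span \<and>
      fconcat (Poly_Mapping.single ws 1) r \<in> relation_span" if "r \<in> relations" for r ws
    using that
  proof (cases rule: relations_cases)
    case (1 us x y vs)
    then show ?thesis using relation_add[of us x y "vs @ ws"] relation_add[of "ws @ us" x y vs]
      by (simp add: lin_diff[OF linear_fconcat_left] lin_diff[OF linear_fconcat_right] fconcat_single)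
  next
    case (2 us c x vs)
    then show ?thesis using relation_scale[of us c x "vs @ ws"] relation_scale[of "ws @ us" c x vs]
      by (simp add: lin_diff[OF linear_fconcat_left] lin_diff[OF linear_fconcat_right]
          lin_scale[OF linear_fconcat_left] lin_scale[OF linear_fconcat_right] fconcat_single)
  qed
  have 2: "fconcat r (Poly_Mapping.single ws 1) \<in> relation_span \<and>
      fconcat (Poly_Mapping.single ws 1) r \<in> relation_span" for ws
    using assms[unfolded relation_span_def]
  proof (induction rule: formal.span_induct)
    case base
    show ?case using subspace_relation_span unfolding formal.subspace_def
      by (simp add: lin_add[OF linear_fconcat_left] lin_add[OF linear_fconcat_right]
          lin_scale[OF linear_fconcat_left] lin_scale[OF linear_fconcat_right]
          lin_0[OF linear_fconcat_left] lin_0[OF linear_fconcat_right])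
  next
    case (step r)
    then show ?case by (rule 1)
  qed
  show "fconcat r p \<in> relation_span" "fconcat p r \<in> relation_span"
    by (subst sum_single[of p], simp add: lin_sum[OF linear_fconcat_left] lin_sum[OF linear_fconcat_right]
      lin_scale[OF linear_fconcat_left] lin_scale[OF linear_fconcat_right] 2
      formal.subspace_sum formal.subspace_scale subspace_relation_span)+
qed

lemma tmul_cls [simp]: "tmul (cls p) (cls q) = cls (fconcat p q)"
proof -
  have "cls (fconcat p' q') = cls (fconcat p q)" if "p' \<in> cls p" "q' \<in> cls q" for p' q'
  proof -
    have "fconcat p' q' - fconcat p q = fconcat (p' - p) q' + fconcat p (q' - q)"
      by (simp add: lin_diff[OF linear_fconcat_left] lin_diff[OF linear_fconcat_right])
    then show ?thesis using that
      by (simp add: cls_eq_iff mem_cls_iff formal.subspace_add subspace_relation_span fconcat_relation)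
  qed
  then show ?thesis unfolding tmul_def by (intro UN_const cls_not_empty) auto
qed

lemma tzero_range [simp]: "tzero \<in> range cls" by (simp add: tzero_def)
lemma pure_range [simp]: "pure xs \<in> range cls" by (simp add: pure_def)
lemma tadd_range [simp]: "u \<in> range cls \<Longrightarrow> v \<in> range cls \<Longrightarrow> tadd u v \<in> range cls" by auto
lemma tdiff_range [simp]: "u \<in> range cls \<Longrightarrow> v \<in> range cls \<Longrightarrow> tdiff u v \<in> range cls" by auto
lemma tscale_range [simp]: "u \<in> range cls \<Longrightarrow> tscale c u \<in> range cls" by auto
lemma tmul_range [simp]: "u \<in> range cls \<Longrightarrow> v \<in> range cls \<Longrightarrow> tmul u v \<in> range cls" by auto

lemma emb_tzero: "emb tzero = 0"
  by (simp add: tzero_def lin_0[OF linear_normal_form])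
lemma emb_tadd: "u \<in> range cls \<Longrightarrow> v \<in> range cls \<Longrightarrow> emb (tadd u v) = emb u + emb v"
  by (auto simp: lin_add[OF linear_normal_form])
lemma emb_tdiff: "u \<in> range cls \<Longrightarrow> v \<in> range cls \<Longrightarrow> emb (tdiff u v) = emb u - emb v"
  by (auto simp: lin_diff[OF linear_normal_form])
lemma emb_tscale: "u \<in> range cls \<Longrightarrow> emb (tscale c u) = fscale c (emb u)"
  by (auto simp: lin_scale[OF linear_normal_form])
lemma emb_inject: "u \<in> range cls \<Longrightarrow> v \<in> range cls \<Longrightarrow> emb u = emb v \<longleftrightarrow> u = v"
  by (metis cls_emb)

lemma tmul_pure: "tmul (pure xs) (pure ys) = pure (xs @ ys)"
  by (simp add: pure_def fconcat_single)

lemma tmul_tadd_left: "u \<in> range cls \<Longrightarrow> u' \<in> range cls \<Longrightarrow> v \<in> range cls \<Longrightarrow>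
    tmul (tadd u u') v = tadd (tmul u v) (tmul u' v)"
  by (auto simp: lin_add[OF linear_fconcat_left])
lemma tmul_tadd_right: "u \<in> range cls \<Longrightarrow> v \<in> range cls \<Longrightarrow> v' \<in> range cls \<Longrightarrow>
    tmul u (tadd v v') = tadd (tmul u v) (tmul u v')"
  by (auto simp: lin_add[OF linear_fconcat_right])
lemma tmul_tdiff_left: "u \<in> range cls \<Longrightarrow> u' \<in> range cls \<Longrightarrow> v \<in> range cls \<Longrightarrow>
    tmul (tdiff u u') v = tdiff (tmul u v) (tmul u' v)"
  by (auto simp: lin_diff[OF linear_fconcat_left])
lemma tmul_tdiff_right: "u \<in> range cls \<Longrightarrow> v \<in> range cls \<Longrightarrow> v' \<in> range cls \<Longrightarrow>
    tmul u (tdiff v v') = tdiff (tmul u v) (tmul u v')"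
  by (auto simp: lin_diff[OF linear_fconcat_right])
lemma tmul_tscale_left: "u \<in> range cls \<Longrightarrow> v \<in> range cls \<Longrightarrow> tmul (tscale c u) v = tscale c (tmul u v)"
  by (auto simp: lin_scale[OF linear_fconcat_left])
lemma tmul_tscale_right: "u \<in> range cls \<Longrightarrow> v \<in> range cls \<Longrightarrow> tmul u (tscale c v) = tscale c (tmul u v)"
  by (auto simp: lin_scale[OF linear_fconcat_right])

lemma pure_add: "pure (us @ (x + y) # vs) = tadd (pure (us @ x # vs)) (pure (us @ y # vs))"
  using relation_add[of us x y vs] by (simp add: pure_def cls_eq_iff diff_diff_add)

lemma pure_scale: "pure (us @ (c *s x) # vs) = tscale c (pure (us @ x # vs))"
  using relation_scale[of us c x vs] by (simp add: pure_def cls_eq_iff)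

section \<open>Tensors of a fixed degree and linear maps on them\<close>

lemma T_range: "u \<in> T n \<Longrightarrow> u \<in> range cls"
  by (auto simp: T_def)

lemma cls_T: "\<forall>xs\<in>Poly_Mapping.keys p. length xs = n \<Longrightarrow> cls p \<in> T n"
  by (auto simp: T_def)

lemma pure_T [simp]: "length xs = n \<Longrightarrow> pure xs \<in> T n"
  by (simp add: pure_def cls_T)

lemma tzero_T [simp]: "tzero \<in> T n"
  by (simp add: tzero_def cls_T)

lemma tadd_T [simp]: "u \<in> T n \<Longrightarrow> v \<in> T n \<Longrightarrow> tadd u v \<in> T n"
proof -
  have "cls (p + q) \<in> T n" if "\<forall>xs\<in>Poly_Mapping.keys p. length xs = n"
    "\<forall>xs\<in>Poly_Mapping.keys q. length xs = n" for p q
    using that Poly_Mapping.keys_add[of p q] by (intro cls_T) blast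
  then show "u \<in> T n \<Longrightarrow> v \<in> T n \<Longrightarrow> tadd u v \<in> T n" by (auto simp: T_def[THEN eqset_imp_iff])
qed

lemma tscale_T [simp]: "u \<in> T n \<Longrightarrow> tscale c u \<in> T n"
proof -
  have "cls (fscale c p) \<in> T n" if "\<forall>xs\<in>Poly_Mapping.keys p. length xs = n" for p
    using that by (intro cls_T) (auto simp: in_keys_iff lookup_fscale)
  then show "u \<in> T n \<Longrightarrow> tscale c u \<in> T n" by (auto simp: T_def[THEN eqset_imp_iff])
qed

lemma tdiff_eq: "u \<in> range cls \<Longrightarrow> v \<in> range cls \<Longrightarrow> tdiff u v = tadd u (tscale (- 1) v)"
  by (auto simp: formal.scale_minus_left)

lemma tdiff_T [simp]: "u \<in> T n \<Longrightarrow> v \<in> T n \<Longrightarrow> tdiff u v \<in> T n"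
  by (simp add: tdiff_eq T_range)

lemma T_induct [consumes 1, case_names zero pure add scale]:
  assumes "u \<in> T n" and "P tzero" and "\<And>xs. length xs = n \<Longrightarrow> P (pure xs)"
    and "\<And>u v. u \<in> T n \<Longrightarrow> v \<in> T n \<Longrightarrow> P u \<Longrightarrow> P v \<Longrightarrow> P (tadd u v)"
    and "\<And>c u. u \<in> T n \<Longrightarrow> P u \<Longrightarrow> P (tscale c u)"
  shows "P u"
proof -
  obtain p where p: "u = cls p" "\<forall>xs\<in>Poly_Mapping.keys p. length xs = n"
    using assms(1) by (auto simp: T_def)
  \<comment> \<open>Membership in \<open>T n\<close> is carried through the induction because the
    cases for sums and multiples assume it of their parts.\<close>
  have "cls (\<Sum>x\<in>A. fscale (c x) (Poly_Mapping.single x 1)) \<in> T n \<and>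
      P (cls (\<Sum>x\<in>A. fscale (c x) (Poly_Mapping.single x 1)))"
    if "finite A" "\<forall>xs\<in>A. length xs = n" for A c
    using that
  proof (induction A rule: finite_induct)
    case empty
    then show ?case using assms(2) tzero_T by (simp add: tzero_def)
  next
    case (insert x A)
    then have "cls (\<Sum>y\<in>insert x A. fscale (c y) (Poly_Mapping.single y 1))
      = tadd (tscale (c x) (pure x)) (cls (\<Sum>x\<in>A. fscale (c x) (Poly_Mapping.single x 1)))"
      by (simp add: pure_def)
    with insert show ?case by (simp add: assms)
  qed
  then show ?thesis using p sum_single[of p] by (metis finite_keys)
qed

lemma linear_on_tadd: "linear_on n f \<Longrightarrow> u \<in> T n \<Longrightarrow> v \<in> T n \<Longrightarrow> f (tadd u v) = tadd (f u) (f v)"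
  and linear_on_tscale: "linear_on n f \<Longrightarrow> u \<in> T n \<Longrightarrow> f (tscale c u) = tscale c (f u)"
  and linear_on_range: "linear_on n f \<Longrightarrow> u \<in> T n \<Longrightarrow> f u \<in> range cls"
  by (auto simp: linear_on_def)

lemma linear_on_tdiff: "linear_on n f \<Longrightarrow> u \<in> T n \<Longrightarrow> v \<in> T n \<Longrightarrow> f (tdiff u v) = tdiff (f u) (f v)"
  by (simp add: tdiff_eq T_range linear_on_range linear_on_tadd linear_on_tscale)

lemma tscale_0: "u \<in> range cls \<Longrightarrow> tscale 0 u = tzero"
  by (auto simp: tzero_def)

lemma linear_on_tzero: "linear_on n f \<Longrightarrow> f tzero = tzero"
  by (metis linear_on_tscale linear_on_range tscale_0 tzero_T T_range)

text \<open>Arbitrary sets are not a group under \<open>tadd\<close>, so the sum is formed between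
  the images under \<open>emb\<close> and sent back to a coset.\<close>

definition tsum :: "'i set \<Rightarrow> ('i \<Rightarrow> ('a, 'k) tensor) \<Rightarrow> ('a, 'k) tensor" where
  "tsum A F = cls (\<Sum>i\<in>A. emb (F i))"

lemma tsum_empty: "tsum {} F = tzero"
  by (simp add: tsum_def tzero_def)

lemma tsum_infinite: "infinite A \<Longrightarrow> tsum A F = tzero"
  by (simp add: tsum_def tzero_def)

lemma tsum_insert: "finite A \<Longrightarrow> i \<notin> A \<Longrightarrow> F i \<in> range cls \<Longrightarrow> tsum (insert i A) F = tadd (F i) (tsum A F)"
  by (simp add: tsum_def flip: tadd_cls) (simp add: cls_emb)

lemma tsum_range [simp]: "tsum A F \<in> range cls"
  by (simp add: tsum_def)

lemma emb_tsum: "emb (tsum A F) = (\<Sum>i\<in>A. emb (F i))"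
proof -
  \<comment> \<open>The projection is idempotent, since \<open>normal_form p\<close> lies in the
    coset of \<open>p\<close>.\<close>
  have "normal_form (emb u) = emb u" for u
    by (simp add: emb_def) (metis cls_normal_form normal_form_cong)
  then show ?thesis by (simp add: tsum_def lin_sum[OF linear_normal_form])
qed

lemma tsum_T [simp]:
  assumes "\<And>i. i \<in> A \<Longrightarrow> F i \<in> T n"
  shows "tsum A F \<in> T n"
  using assms
proof (induction A rule: infinite_finite_induct)
  case (insert x A)
  then show ?case using T_range[of "F x" n] by (simp add: tsum_insert)
qed (simp_all add: tsum_empty tsum_infinite)

lemma linear_on_tsum:
  assumes "linear_on n f" "\<And>i. i \<in> A \<Longrightarrow> F i \<in> T n"
  shows "f (tsum A F) = tsum A (\<lambda>i. f (F i))"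
  using assms(2)
proof (induction A rule: infinite_finite_induct)
  case (insert x A)
  then show ?case using T_range[of "F x" n]
    by (simp add: tsum_insert linear_on_tadd[OF assms(1)] linear_on_range[OF assms(1)])
qed (simp_all add: tsum_empty tsum_infinite linear_on_tzero[OF assms(1)])

lemma tmul_tzero: "u \<in> range cls \<Longrightarrow> tmul u tzero = tzero" "u \<in> range cls \<Longrightarrow> tmul tzero u = tzero"
  by (auto simp: tzero_def lin_0[OF linear_fconcat_left] lin_0[OF linear_fconcat_right])

lemma tmul_tsum:
  assumes "u \<in> range cls" "\<And>i. i \<in> A \<Longrightarrow> F i \<in> range cls"
  shows "tmul u (tsum A F) = tsum A (\<lambda>i. tmul u (F i))" "tmul (tsum A F) u = tsum A (\<lambda>i. tmul (F i) u)"
proof -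
  have "tmul u (tsum A F) = tsum A (\<lambda>i. tmul u (F i)) \<and> tmul (tsum A F) u = tsum A (\<lambda>i. tmul (F i) u)"
    using assms(2)
  proof (induction A rule: infinite_finite_induct)
    case (insert x A)
    then have x: "F x \<in> range cls"
      and IH: "tmul u (tsum A F) = tsum A (\<lambda>i. tmul u (F i))" "tmul (tsum A F) u = tsum A (\<lambda>i. tmul (F i) u)"
      by auto
    show ?case
      by (simp only: tsum_insert[OF insert.hyps] IH x assms(1) tmul_range tsum_range tmul_tadd_left tmul_tadd_right)
  qed (simp_all add: tsum_empty tsum_infinite tmul_tzero assms(1))
  then show "tmul u (tsum A F) = tsum A (\<lambda>i. tmul u (F i))" "tmul (tsum A F) u = tsum A (\<lambda>i. tmul (F i) u)"
    by simp_all
qed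

lemma tmul_T:
  assumes "u \<in> T m" "v \<in> T n"
  shows "tmul u v \<in> T (m + n)"
proof -
  have 1: "tmul (pure xs) v \<in> T (m + n)" if "length xs = m" for xs
    using assms(2)
    by (induction rule: T_induct) (simp_all add: that tmul_pure tmul_tzero tmul_tadd_right tmul_tscale_right T_range)
  show ?thesis using assms(1)
    by (induction rule: T_induct) (simp_all add: 1 assms(2)[THEN T_range] tmul_tzero tmul_tadd_left tmul_tscale_left T_range)
qed

section \<open>Universal property of the tensor powers\<close>

definition multilinear :: "nat \<Rightarrow> ('k \<Rightarrow> 'b \<Rightarrow> 'b) \<Rightarrow> ('a list \<Rightarrow> 'b::ab_group_add) \<Rightarrow> bool" where
  "multilinear n s F \<longleftrightarrow> (\<forall>us x y vs. Suc (length us + length vs) = n \<longrightarrow>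
      F (us @ (x + y) # vs) = F (us @ x # vs) + F (us @ y # vs)) \<and>
    (\<forall>us c x vs. Suc (length us + length vs) = n \<longrightarrow> F (us @ (c *s x) # vs) = s c (F (us @ x # vs)))"

lemma multilinear_extension:
  assumes "vector_space s" "multilinear n s F"
  shows "\<exists>h. Vector_Spaces.linear fscale s h \<and> (\<forall>p q. cls p = cls q \<longrightarrow> h p = h q) \<and>
    (\<forall>xs. length xs = n \<longrightarrow> h (Poly_Mapping.single xs 1) = F xs)"
proof -
  interpret W: vector_space s by fact
  \<comment> \<open>The relations of all word lengths are divided out at once, while
    \<open>F\<close> is multilinear only on words of length \<open>n\<close>; the value 0 elsewhere
    makes the extension vanish on the remaining relations.\<close>
  let ?G = "\<lambda>xs. if length xs = n then F xs else 0"
  note L = linear_fext[OF assms(1), of ?G]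
  have "fext s ?G r = 0" if "r \<in> relation_span" for r
  proof (rule lin_vanish_span[OF L _ that[unfolded relation_span_def]])
    fix r assume "r \<in> relations"
    then show "fext s ?G r = 0"
    proof (cases rule: relations_cases)
      case (1 us x y vs)
      then show ?thesis using assms(2)[unfolded multilinear_def, THEN conjunct1, rule_format, of us vs x y]
        by (simp add: lin_diff[OF L] fext_single[OF assms(1)])
    next
      case (2 us c x vs)
      then show ?thesis using assms(2)[unfolded multilinear_def, THEN conjunct2, rule_format, of us vs c x]
        by (simp add: lin_diff[OF L] lin_scale[OF L] fext_single[OF assms(1)])
    qed
  qed
  then have 1: "fext s ?G p = fext s ?G q" if "cls p = cls q" for p q
    using that lin_diff[OF L, of p q] by (simp add: cls_eq_iff)
  have 2: "fext s ?G (Poly_Mapping.single xs 1) = F xs" if "length xs = n" for xs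
    using that by (simp add: fext_single[OF assms(1)])
  show ?thesis
    by (intro exI[of _ "fext s ?G"] conjI allI impI L) (fact 1, fact 2)
qed

definition pt :: "'a list \<Rightarrow> ('a list \<Rightarrow>\<^sub>0 'k)" where "pt xs = emb (pure xs)"

lemma multilinear_pt: "multilinear n fscale pt"
  by (simp add: multilinear_def pt_def pure_add pure_scale emb_tadd emb_tscale)

text \<open>Through \<open>h\<close> an identity between tensors becomes an identity between values
  of any multilinear function in any vector space.\<close>

lemma multilinear_factors_pt:
  assumes "vector_space s" "multilinear n s F"
  shows "\<exists>h. Vector_Spaces.linear fscale s h \<and> (\<forall>xs. length xs = n \<longrightarrow> F xs = h (pt xs))"
proof -
  obtain h where h: "Vector_Spaces.linear fscale s h" "\<And>p q. cls p = cls q \<Longrightarrow> h p = h q"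
    "\<And>xs. length xs = n \<Longrightarrow> h (Poly_Mapping.single xs 1) = F xs"
    using multilinear_extension[OF assms] by blast
  have "h (pt xs) = h (Poly_Mapping.single xs 1)" for xs
    by (rule h(2)) (simp add: pt_def pure_def)
  with h show ?thesis by metis
qed

lemma ex_lift:
  assumes "multilinear n fscale (\<lambda>xs. emb (F xs))" "\<And>xs. length xs = n \<Longrightarrow> F xs \<in> range cls"
  shows "\<exists>f. linear_on n f \<and> (\<forall>xs. length xs = n \<longrightarrow> f (pure xs) = F xs)"
proof -
  obtain h where h: "Vector_Spaces.linear fscale fscale h" "\<And>p q. cls p = cls q \<Longrightarrow> h p = h q"
    "\<And>xs. length xs = n \<Longrightarrow> h (Poly_Mapping.single xs 1) = emb (F xs)"
    using multilinear_extension[OF formal.vector_space_axioms assms(1)] by blast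
  define f where "f u = cls (h (SOME p. p \<in> u))" for u
  have f: "f (cls p) = cls (h p)" for p
    unfolding f_def by (subst h(2)[OF some_cls]) simp
  have "linear_on n f" unfolding linear_on_def
  proof (intro conjI ballI allI)
    fix u v c assume "u \<in> T n" "v \<in> T n"
    then obtain p q where "u = cls p" "v = cls q" by (auto simp: T_def)
    then show "f (tadd u v) = tadd (f u) (f v)" by (simp add: f lin_add[OF h(1)])
  next
    fix u c assume "u \<in> T n"
    then obtain p where "u = cls p" by (auto simp: T_def)
    then show "f u \<in> range cls" "f (tscale c u) = tscale c (f u)" by (simp_all add: f lin_scale[OF h(1)])
  qed
  moreover have "f (pure xs) = F xs" if "length xs = n" for xs
    by (simp add: pure_def f h(3) that cls_emb assms(2) del: emb_cls)
  ultimately show ?thesis by blast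
qed

text \<open>\<open>lift\<close> is given by a choice, so nothing is known about it until
  \<open>ex_lift\<close> supplies a witness.\<close>

lemma lift:
  assumes "multilinear n fscale (\<lambda>xs. emb (F xs))" "\<And>xs. length xs = n \<Longrightarrow> F xs \<in> range cls"
  shows linear_on_lift: "linear_on n (lift n F)"
    and lift_pure: "length xs = n \<Longrightarrow> lift n F (pure xs) = F xs"
  using someI_ex[OF ex_lift[OF assms]] unfolding lift_def by auto

lemma tens:
  assumes "linear_on m f" "linear_on n g"
  shows linear_on_tens: "linear_on (m + n) (f \<otimes>\<^bsub>m,n\<^esub> g)"
    and tens_pure: "length xs = m + n \<Longrightarrow>
      (f \<otimes>\<^bsub>m,n\<^esub> g) (pure xs) = tmul (f (pure (take m xs))) (g (pure (drop m xs)))"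
proof -
  let ?F = "\<lambda>xs. tmul (f (pure (take m xs))) (g (pure (drop m xs)))"
  note [simp] = linear_on_tadd[OF assms(1)] linear_on_tadd[OF assms(2)] linear_on_tscale[OF assms(1)]
    linear_on_tscale[OF assms(2)] linear_on_range[OF assms(1)] linear_on_range[OF assms(2)]
  have "emb (?F (us @ (x + y) # vs)) = emb (?F (us @ x # vs)) + emb (?F (us @ y # vs)) \<and>
      emb (?F (us @ (c *s x) # vs)) = fscale c (emb (?F (us @ x # vs)))"
    if "Suc (length us + length vs) = m + n" for us x y vs c
  proof (cases "length us < m")
    case True
    \<comment> \<open>Written as a successor, \<open>m - length us\<close> lets
      \<open>take m\<close> and \<open>drop m\<close> compute past the changed entry, which lies in
      the first factor.\<close>
    then obtain k where "m - length us = Suc k" by (metis Suc_diff_Suc)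
    with True that show ?thesis
      by (simp add: pure_add pure_scale tmul_tadd_left tmul_tscale_left emb_tadd emb_tscale)
  next
    case False
    then show ?thesis using that
      by (simp add: pure_add pure_scale tmul_tadd_right tmul_tscale_right emb_tadd emb_tscale)
  qed
  then have 1: "multilinear (m + n) fscale (\<lambda>xs. emb (?F xs))"
    unfolding multilinear_def by blast
  have 2: "?F xs \<in> range cls" if "length xs = m + n" for xs
    using that by simp
  show "linear_on (m + n) (f \<otimes>\<^bsub>m,n\<^esub> g)" unfolding tens_def by (rule linear_on_lift[OF 1 2])
  show "(f \<otimes>\<^bsub>m,n\<^esub> g) (pure xs) = ?F xs" if "length xs = m + n"
    unfolding tens_def by (rule lift_pure[OF 1 2 that])
qed

section \<open>Closure properties of the spaces of linear maps\<close>

lemma HomI: "linear_on n f \<Longrightarrow> (\<And>xs. length xs = n \<Longrightarrow> f (pure xs) \<in> T m) \<Longrightarrow> f \<in> Hom n m"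
proof -
  assume f: "linear_on n f" "\<And>xs. length xs = n \<Longrightarrow> f (pure xs) \<in> T m"
  have "f u \<in> T m" if "u \<in> T n" for u
    using that by (induction rule: T_induct)
      (simp_all add: f linear_on_tzero[OF f(1)] linear_on_tadd[OF f(1)] linear_on_tscale[OF f(1)])
  with f(1) show ?thesis by (simp add: Hom_def)
qed

lemma Hom_linear_on: "f \<in> Hom n m \<Longrightarrow> linear_on n f"
  and Hom_T: "f \<in> Hom n m \<Longrightarrow> u \<in> T n \<Longrightarrow> f u \<in> T m"
  by (auto simp: Hom_def)

lemma Hom_id: "id \<in> Hom n n"
  by (simp add: Hom_def linear_on_def T_range)

lemma Hom_comp: "g \<in> Hom n m \<Longrightarrow> f \<in> Hom m l \<Longrightarrow> f \<circ> g \<in> Hom n l"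
  unfolding Hom_def linear_on_def by simp

text \<open>The degrees \<open>N\<close> and \<open>M\<close> are tied to the sums by premises,
  because a numeral such as 3 would not unify with \<open>m + n\<close>.\<close>

lemma Hom_tens:
  assumes "f \<in> Hom m m'" "g \<in> Hom n n'" "N = m + n" "M = m' + n'"
  shows "f \<otimes>\<^bsub>m,n\<^esub> g \<in> Hom N M"
  unfolding assms(3,4)
  by (rule HomI) (use assms in \<open>simp_all add: linear_on_tens tens_pure Hom_linear_on tmul_T Hom_T\<close>)

lemma Hom_hadd: "f \<in> Hom n m \<Longrightarrow> g \<in> Hom n m \<Longrightarrow> f \<boxplus> g \<in> Hom n m"
proof -
  assume fg: "f \<in> Hom n m" "g \<in> Hom n m"
  note [simp] = fg[THEN Hom_linear_on, THEN linear_on_tadd] fg[THEN Hom_linear_on, THEN linear_on_tscale]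
    fg[THEN Hom_T] fg[THEN Hom_linear_on, THEN linear_on_range]
  have "tadd (tadd a b) (tadd c d) = tadd (tadd a c) (tadd b d)"
    if "a \<in> range cls" "b \<in> range cls" "c \<in> range cls" "d \<in> range cls" for a b c d
    using that by (auto simp: algebra_simps)
  moreover have "tadd (tscale k a) (tscale k b) = tscale k (tadd a b)"
    if "a \<in> range cls" "b \<in> range cls" for a b k
    using that by (auto simp: formal.scale_right_distrib)
  ultimately show ?thesis by (simp add: Hom_def linear_on_def hadd_def)
qed

lemma Hom_hdiff: "f \<in> Hom n m \<Longrightarrow> g \<in> Hom n m \<Longrightarrow> f \<boxminus> g \<in> Hom n m"
proof -
  assume fg: "f \<in> Hom n m" "g \<in> Hom n m"
  note [simp] = fg[THEN Hom_linear_on, THEN linear_on_tadd] fg[THEN Hom_linear_on, THEN linear_on_tscale]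
    fg[THEN Hom_T] fg[THEN Hom_linear_on, THEN linear_on_range]
  have "tdiff (tadd a b) (tadd c d) = tadd (tdiff a c) (tdiff b d)"
    if "a \<in> range cls" "b \<in> range cls" "c \<in> range cls" "d \<in> range cls" for a b c d
    using that by (auto simp: algebra_simps)
  moreover have "tdiff (tscale k a) (tscale k b) = tscale k (tdiff a b)"
    if "a \<in> range cls" "b \<in> range cls" for a b k
    using that by (auto simp: formal.scale_right_diff_distrib)
  ultimately show ?thesis by (simp add: Hom_def linear_on_def hdiff_def)
qed

lemma multilinear_1I:
  assumes "\<And>x y. F [x + y] = F [x] + F [y]" "\<And>c x. F [c *s x] = s c (F [x])"
  shows "multilinear 1 s F"
  unfolding multilinear_def using assms by auto

lemma multilinear_2I:
  assumes "\<And>x y z. F [x + y, z] = F [x, z] + F [y, z]" "\<And>c x z. F [c *s x, z] = s c (F [x, z])"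
    and "\<And>x y z. F [z, x + y] = F [z, x] + F [z, y]" "\<And>c x z. F [z, c *s x] = s c (F [z, x])"
  shows "multilinear 2 s F"
proof -
  have *: "us = [] \<and> (\<exists>z. vs = [z]) \<or> vs = [] \<and> (\<exists>z. us = [z])"
    if "Suc (length us + length vs) = 2" for us vs :: "'a list"
    using that by (cases us; cases vs) (auto simp: numeral_2_eq_2)
  show ?thesis unfolding multilinear_def
    by (intro conjI allI impI) (drule *, elim disjE conjE exE, simp add: assms, simp add: assms)+
qed

lemma pure_nth_add:
  "pure [x + y] = tadd (pure [x]) (pure [y])"
  "pure [x + y, b] = tadd (pure [x, b]) (pure [y, b])"
  "pure [a, x + y] = tadd (pure [a, x]) (pure [a, y])"
  "pure [x + y, b, c] = tadd (pure [x, b, c]) (pure [y, b, c])"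
  "pure [a, x + y, c] = tadd (pure [a, x, c]) (pure [a, y, c])"
  "pure [a, b, x + y] = tadd (pure [a, b, x]) (pure [a, b, y])"
  using pure_add[of "[]"] pure_add[of "[a]"] pure_add[of "[a, b]"] by simp_all

lemma pure_nth_scale:
  "pure [k *s x] = tscale k (pure [x])"
  "pure [k *s x, b] = tscale k (pure [x, b])"
  "pure [a, k *s x] = tscale k (pure [a, x])"
  "pure [k *s x, b, c] = tscale k (pure [x, b, c])"
  "pure [a, k *s x, c] = tscale k (pure [a, x, c])"
  "pure [a, b, k *s x] = tscale k (pure [a, b, x])"
  using pure_scale[of "[]"] pure_scale[of "[a]"] pure_scale[of "[a, b]"] by simp_all

lemma tau: shows linear_on_tau: "linear_on 2 \<tau>" and tau_pure: "\<tau> (pure [x, y]) = pure [y, x]"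
proof -
  have *: "multilinear 2 fscale (\<lambda>xs. emb (pure [xs ! 1, xs ! 0]))"
    by (rule multilinear_2I) (simp_all add: pure_nth_add pure_nth_scale emb_tadd emb_tscale)
  show "linear_on 2 \<tau>" "\<tau> (pure [x, y]) = pure [y, x]"
    unfolding \<tau>_def by (rule linear_on_lift[OF *], simp) (subst lift_pure[OF *], simp_all)
qed

text \<open>The identity of \<open>'a\<close> is multilinear in one variable and hence factors
  through \<open>pure [x]\<close>; this shows that dividing by the relations does not collapse
  H.\<close>

lemma pure_singleton_inject [simp]: "pure [x] = pure [y] \<longleftrightarrow> x = y"
proof
  have "multilinear 1 scale (\<lambda>xs. xs ! 0)"
    by (rule multilinear_1I) simp_all
  from multilinear_factors_pt[OF vector_space_axioms this]
  obtain h where h: "\<And>xs. length xs = 1 \<Longrightarrow> xs ! 0 = h (pt xs)" by blast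
  assume "pure [x] = pure [y]"
  then show "x = y" using h[of "[x]"] h[of "[y]"] by (simp add: pt_def)
qed simp

lemma pure_0: "pure [0] = tzero"
  using pure_nth_scale(1)[of 0 0] tscale_0[of "pure [0]"] by simp

lemma T_1E:
  assumes "u \<in> T 1"
  obtains x where "u = pure [x]"
proof -
  have "\<exists>x. u = pure [x]" using assms
  proof (induction rule: T_induct)
    case zero
    show ?case using pure_0 by metis
  next
    case (pure xs)
    then show ?case by (auto simp: length_Suc_conv)
  qed (metis pure_nth_add(1), metis pure_nth_scale(1))
  with that show thesis by blast
qed

definition hval :: "('a, 'k) tensor \<Rightarrow> 'a" where
  "hval u = (SOME x. u = pure [x])"

lemma hval_pure [simp]: "hval (pure [x]) = x"
  by (simp add: hval_def)

lemma pure_hval: "u \<in> T 1 \<Longrightarrow> pure [hval u] = u"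
  by (metis T_1E hval_pure)

lemma tadd_pure: "tadd (pure [x]) (pure [y]) = pure [x + y]"
  by (simp add: pure_nth_add)

lemma tdiff_pure: "tdiff (pure [x]) (pure [y]) = pure [x - y]"
  using pure_nth_scale(1)[of "- 1" y] by (simp add: tdiff_eq tadd_pure flip: pure_nth_scale)

lemma pt_add:
  "pt [x + y] = pt [x] + pt [y]"
  "pt [x + y, b] = pt [x, b] + pt [y, b]"
  "pt [a, x + y] = pt [a, x] + pt [a, y]"
  "pt [x + y, b, c] = pt [x, b, c] + pt [y, b, c]"
  "pt [a, x + y, c] = pt [a, x, c] + pt [a, y, c]"
  "pt [a, b, x + y] = pt [a, b, x] + pt [a, b, y]"
  by (simp_all add: pt_def pure_nth_add emb_tadd)

lemma pt_scale:
  "pt [k *s x] = fscale k (pt [x])"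
  "pt [k *s x, b] = fscale k (pt [x, b])"
  "pt [a, k *s x] = fscale k (pt [a, x])"
  "pt [k *s x, b, c] = fscale k (pt [x, b, c])"
  "pt [a, k *s x, c] = fscale k (pt [a, x, c])"
  "pt [a, b, k *s x] = fscale k (pt [a, b, x])"
  by (simp_all add: pt_def pure_nth_scale emb_tscale)

lemma pt_diff: "pt [x - y, b] = pt [x, b] - pt [y, b]"
  using pt_add(2)[of "x - y" y b] by simp

lemma Hom_eq_tzero:
  assumes "g \<in> Hom n m" "\<And>xs. length xs = n \<Longrightarrow> g (pure xs) = tzero" "u \<in> T n"
  shows "g u = tzero"
  using assms(3)
  by (induction rule: T_induct) (simp_all add: assms(2) linear_on_tzero[OF Hom_linear_on[OF assms(1)]]
    linear_on_tadd[OF Hom_linear_on[OF assms(1)]] linear_on_tscale[OF Hom_linear_on[OF assms(1)]],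
    simp_all add: tzero_def)

definition bilin :: "('k \<Rightarrow> 'b \<Rightarrow> 'b) \<Rightarrow> ('a \<Rightarrow> 'a \<Rightarrow> 'b::ab_group_add) \<Rightarrow> bool" where
  "bilin s F \<longleftrightarrow> vector_space s \<and>
    (\<forall>x y b. F (x + y) b = F x b + F y b) \<and> (\<forall>c x b. F (c *s x) b = s c (F x b)) \<and>
    (\<forall>a x y. F a (x + y) = F a x + F a y) \<and> (\<forall>c a x. F a (c *s x) = s c (F a x))"

definition trilin :: "('k \<Rightarrow> 'b \<Rightarrow> 'b) \<Rightarrow> ('a \<Rightarrow> 'a \<Rightarrow> 'a \<Rightarrow> 'b::ab_group_add) \<Rightarrow> bool" where
  "trilin s F \<longleftrightarrow> (\<forall>a. bilin s (F a)) \<and>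
    (\<forall>x y b c. F (x + y) b c = F x b c + F y b c) \<and> (\<forall>k x b c. F (k *s x) b c = s k (F x b c))"

lemma bilin_simps:
  assumes "bilin s F"
  shows "F (x + y) b = F x b + F y b" "F (c *s x) b = s c (F x b)"
   "F a (x + y) = F a x + F a y" "F a (c *s x) = s c (F a x)"
  using assms by (simp_all add: bilin_def)

lemma bilin_factors_pt:
  assumes "bilin s F"
  obtains h where "Vector_Spaces.linear fscale s h" "\<And>a b. F a b = h (pt [a, b])"
proof -
  have "multilinear 2 s (\<lambda>xs. F (xs ! 0) (xs ! 1))"
    by (rule multilinear_2I) (use assms in \<open>simp_all add: bilin_def\<close>)
  moreover have "vector_space s" using assms by (simp add: bilin_def)
  ultimately obtain h where h: "Vector_Spaces.linear fscale s h"
    "\<And>xs. length xs = 2 \<Longrightarrow> F (xs ! 0) (xs ! 1) = h (pt xs)"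
    using multilinear_factors_pt by blast
  with h(2)[of "[_, _]"] that show thesis by simp
qed

lemma trilin_factors_pt:
  assumes "trilin s F"
  obtains h where "Vector_Spaces.linear fscale s h" "\<And>a b c. F a b c = h (pt [a, b, c])"
proof -
  have *: "us = [] \<and> (\<exists>y z. vs = [y, z]) \<or> (\<exists>y. us = [y]) \<and> (\<exists>z. vs = [z]) \<or> (\<exists>y z. us = [y, z]) \<and> vs = []"
    if "Suc (length us + length vs) = 3" for us vs :: "'a list"
  proof -
    have "length us = 0 \<and> length vs = 2 \<or> length us = 1 \<and> length vs = 1 \<or> length us = 2 \<and> length vs = 0"
      using that by arith
    then show ?thesis by (auto simp: length_Suc_conv numeral_2_eq_2)
  qed
  have "multilinear 3 s (\<lambda>xs. F (xs ! 0) (xs ! 1) (xs ! 2))"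
    unfolding multilinear_def
    by (intro conjI allI impI; drule *; elim disjE conjE exE)
      (use assms in \<open>simp_all add: trilin_def bilin_def\<close>)
  moreover have "vector_space s" using assms by (simp add: trilin_def bilin_def)
  ultimately obtain h where h: "Vector_Spaces.linear fscale s h"
    "\<And>xs. length xs = 3 \<Longrightarrow> F (xs ! 0) (xs ! 1) (xs ! 2) = h (pt xs)"
    using multilinear_factors_pt by blast
  with h(2)[of "[_, _, _]"] that show thesis by simp
qed

end

section \<open>Sweedler calculus\<close>

context hopf_algebra
begin

definition rep :: "'a \<Rightarrow> ('a list \<Rightarrow>\<^sub>0 'k)" where
  "rep x = (SOME p. comult x = cls p \<and> (\<forall>xs\<in>Poly_Mapping.keys p. length xs = 2))"

lemma rep: shows cls_rep: "cls (rep x) = comult x"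
  and length_rep: "xs \<in> Poly_Mapping.keys (rep x) \<Longrightarrow> length xs = 2"
proof -
  have "\<exists>p. comult x = cls p \<and> (\<forall>xs\<in>Poly_Mapping.keys p. length xs = 2)"
    using comult_closed[of x] by (auto simp: T_def)
  from someI_ex[OF this] show "cls (rep x) = comult x"
    "xs \<in> Poly_Mapping.keys (rep x) \<Longrightarrow> length xs = 2" by (auto simp: rep_def)
qed

text \<open>\<open>sw x (\<lambda>a b. F a b)\<close> is the Sweedler sum \<open>F x\<^sub>(\<^sub>1\<^sub>) x\<^sub>(\<^sub>2\<^sub>)\<close>.  Unless \<open>F\<close> is bilinear, it depends on the
  chosen representative of \<open>comult x\<close>.\<close>

definition sw :: "'a \<Rightarrow> ('a \<Rightarrow> 'a \<Rightarrow> 'b::comm_monoid_add) \<Rightarrow> 'b" where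
  "sw x F = (\<Sum>xs\<in>Poly_Mapping.keys (rep x). F (Poly_Mapping.lookup (rep x) xs *s xs ! 0) (xs ! 1))"

text \<open>The counterpart of \<open>sw\<close> for summands that are tensors;
  \<open>emb_tsw\<close> translates it into \<open>sw\<close>. As in \<open>sw\<close>, the
  coefficient of a word goes into the first argument, so that the target needs no scalar
  multiplication.\<close>

definition tsw :: "'a \<Rightarrow> ('a \<Rightarrow> 'a \<Rightarrow> ('a, 'k) tensor) \<Rightarrow> ('a, 'k) tensor" where
  "tsw x F = tsum (Poly_Mapping.keys (rep x))
    (\<lambda>xs. F (Poly_Mapping.lookup (rep x) xs *s xs ! 0) (xs ! 1))"

lemma tsw_range [simp]: "tsw x F \<in> range cls"
  by (simp add: tsw_def)

lemma tsw_T [simp]: "(\<And>a b. F a b \<in> T n) \<Longrightarrow> tsw x F \<in> T n"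
  by (simp add: tsw_def)

lemma emb_tsw: "emb (tsw x F) = sw x (\<lambda>a b. emb (F a b))"
  by (simp add: tsw_def sw_def emb_tsum)

lemma linear_on_tsw: "linear_on n f \<Longrightarrow> (\<And>a b. F a b \<in> T n) \<Longrightarrow> f (tsw x F) = tsw x (\<lambda>a b. f (F a b))"
  by (simp add: tsw_def linear_on_tsum)

lemma tmul_tsw:
  "u \<in> range cls \<Longrightarrow> (\<And>a b. F a b \<in> range cls) \<Longrightarrow> tmul u (tsw x F) = tsw x (\<lambda>a b. tmul u (F a b))"
  "u \<in> range cls \<Longrightarrow> (\<And>a b. F a b \<in> range cls) \<Longrightarrow> tmul (tsw x F) u = tsw x (\<lambda>a b. tmul (F a b) u)"
  by (simp_all add: tsw_def tmul_tsum)

lemma comult_tsw: "comult x = tsw x (\<lambda>a b. pure [a, b])"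
proof -
  have "emb (cls (rep x)) = emb (tsw x (\<lambda>a b. pure [a, b]))"
  proof -
    have "normal_form (rep x) = normal_form (\<Sum>xs\<in>Poly_Mapping.keys (rep x).
        fscale (Poly_Mapping.lookup (rep x) xs) (Poly_Mapping.single xs 1))"
      by (subst sum_single) simp
    also have "\<dots> = (\<Sum>xs\<in>Poly_Mapping.keys (rep x). emb (tscale (Poly_Mapping.lookup (rep x) xs) (pure xs)))"
      by (simp add: lin_sum[OF linear_normal_form] pure_def)
    also have "\<dots> = emb (tsw x (\<lambda>a b. pure [a, b]))"
    proof -
      have "[xs ! 0, xs ! 1] = xs" if "xs \<in> Poly_Mapping.keys (rep x)" for xs
        using length_rep[OF that] by (auto simp: length_Suc_conv numeral_2_eq_2)
      then show ?thesis by (simp add: emb_tsw sw_def pure_nth_scale)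
    qed
    finally show ?thesis by simp
  qed
  then show ?thesis by (simp only: emb_inject tsw_range rangeI) (simp add: cls_rep)
qed

lemma tsw_tdiff:
  assumes "\<And>a b. F a b \<in> range cls" "\<And>a b. G a b \<in> range cls"
  shows "tsw x (\<lambda>a b. tdiff (F a b) (G a b)) = tdiff (tsw x F) (tsw x G)"
  using assms by (subst emb_inject[symmetric]) (simp_all add: emb_tsw emb_tdiff sw_def sum_subtractf)

lemma sw_add: "sw x (\<lambda>a b. F a b + G a b) = sw x F + sw x G"
  by (simp add: sw_def sum.distrib)

lemma sw_diff:
  fixes F :: "'a \<Rightarrow> 'a \<Rightarrow> 'b::ab_group_add"
  shows "sw x (\<lambda>a b. F a b - G a b) = sw x F - sw x G"
  by (simp add: sw_def sum_subtractf)

lemma sw_swap: "sw x (\<lambda>a b. sw y (\<lambda>c d. F a b c d)) = sw y (\<lambda>c d. sw x (\<lambda>a b. F a b c d))"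
  by (simp add: sw_def sum.swap[of _ "Poly_Mapping.keys (rep y)"])

lemma sw_linear: "Vector_Spaces.linear s t h \<Longrightarrow> h (sw x F) = sw x (\<lambda>a b. h (F a b))"
  by (simp add: sw_def lin_sum)

lemma sw_fscale: "sw x (\<lambda>a b. fscale c (F a b)) = fscale c (sw x F)"
  by (simp add: sw_def formal.scale_sum_right)

lemma sw_scale: "sw x (\<lambda>a b. c *s (F a b)) = c *s (sw x F)"
  by (simp add: sw_def scale_sum_right)

lemma sw_mult:
  fixes F :: "'a \<Rightarrow> 'a \<Rightarrow> 'a"
  shows "sw x (\<lambda>a b. F a b * c) = sw x F * c" "sw x (\<lambda>a b. c * F a b) = c * sw x F"
  by (simp_all add: sw_def sum_distrib_left sum_distrib_right)

text \<open>A bilinear \<open>F\<close> factors as \<open>h\<close> after \<open>pt\<close>, so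
  \<open>sw x F\<close> equals \<open>h (emb (comult x))\<close>. This no longer mentions the chosen
  representative and is linear in \<open>x\<close> because \<open>comult\<close> is.\<close>

lemma bilin_sw_additive:
  assumes "bilin s F"
  shows sw_arg_add: "sw (x + y) F = sw x F + sw y F" and sw_arg_scale: "sw (c *s x) F = s c (sw x F)"
proof -
  obtain h where h: "Vector_Spaces.linear fscale s h" "\<And>a b. F a b = h (pt [a, b])"
    using bilin_factors_pt[OF assms] by blast
  have "F = (\<lambda>a b. h (pt [a, b]))" using h(2) by auto
  then have *: "sw x F = h (emb (comult x))" for x
    by (simp add: comult_tsw emb_tsw sw_linear[OF h(1)] flip: pt_def)
  have c: "comult x \<in> range cls" for x by (simp add: comult_tsw)
  show "sw (x + y) F = sw x F + sw y F" "sw (c *s x) F = s c (sw x F)"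
    by (simp_all only: * comult_add comult_scale c emb_tadd emb_tscale lin_add[OF h(1)] lin_scale[OF h(1)])
qed

lemma antipode_add: "antipode (x + y) = antipode x + antipode y"
  and antipode_scale: "antipode (c *s x) = c *s antipode x"
  using lin_add[OF antipode_linear] lin_scale[OF antipode_linear] by auto

lemma counit_add: "counit (x + y) = counit x + counit y"
  and counit_scale: "counit (c *s x) = c * counit x"
  using lin_add[OF counit_linear] lin_scale[OF counit_linear] by auto

lemma tsw_pure: "tsw x (\<lambda>a b. pure [F a b]) = pure [sw x F]"
proof -
  have *: "tsum A (\<lambda>i. pure [g i]) = pure [\<Sum>i\<in>A. g i]" if "finite A" for A :: "'i set" and g
    using that
  proof (induction A rule: finite_induct)
    case empty
    then show ?case by (simp add: tsum_empty pure_0)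
  qed (simp add: tsum_insert pure_nth_add)
  show ?thesis by (simp add: tsw_def sw_def *)
qed

section \<open>The structure maps on elementary tensors\<close>

lemma mu: shows linear_on_mu: "linear_on 2 \<mu>" and mu_pure: "\<mu> (pure [x, y]) = pure [x * y]"
proof -
  have *: "multilinear 2 fscale (\<lambda>xs. emb (pure [xs ! 0 * xs ! 1]))"
    by (rule multilinear_2I) (simp_all add: pure_nth_add pure_nth_scale emb_tadd emb_tscale
        scale_mult_left scale_mult_right distrib_left distrib_right)
  show "linear_on 2 \<mu>" "\<mu> (pure [x, y]) = pure [x * y]"
    unfolding \<mu>_def by (rule linear_on_lift[OF *], simp) (subst lift_pure[OF *], simp_all)
qed

lemma Delta: shows linear_on_Delta: "linear_on 1 \<Delta>" and Delta_pure: "\<Delta> (pure [x]) = tsw x (\<lambda>a b. pure [a, b])"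
proof -
  have c: "comult x \<in> range cls" for x by (simp add: comult_tsw)
  have *: "multilinear 1 fscale (\<lambda>xs. emb (comult (xs ! 0)))"
    by (rule multilinear_1I) (simp_all add: comult_add comult_scale emb_tadd emb_tscale c)
  show "linear_on 1 \<Delta>" "\<Delta> (pure [x]) = tsw x (\<lambda>a b. pure [a, b])"
    unfolding \<Delta>_def by (rule linear_on_lift[OF *], simp add: c) (subst lift_pure[OF *], simp_all add: c flip: comult_tsw)
qed

lemma eps: shows linear_on_eps: "linear_on 1 \<epsilon>" and eps_pure: "\<epsilon> (pure [x]) = tscale (counit x) (pure [])"
proof -
  have *: "multilinear 1 fscale (\<lambda>xs. emb (tscale (counit (xs ! 0)) (pure [])))"
    by (rule multilinear_1I) (simp_all add: counit_add counit_scale emb_tscale formal.scale_left_distrib)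
  show "linear_on 1 \<epsilon>" "\<epsilon> (pure [x]) = tscale (counit x) (pure [])"
    unfolding \<epsilon>_def by (rule linear_on_lift[OF *], simp) (subst lift_pure[OF *], simp_all)
qed

lemma S: shows linear_on_S: "linear_on 1 S" and S_pure: "S (pure [x]) = pure [antipode x]"
proof -
  have *: "multilinear 1 fscale (\<lambda>xs. emb (pure [antipode (xs ! 0)]))"
    by (rule multilinear_1I) (simp_all add: antipode_add antipode_scale pure_nth_add pure_nth_scale emb_tadd emb_tscale)
  show "linear_on 1 S" "S (pure [x]) = pure [antipode x]"
    unfolding S_def by (rule linear_on_lift[OF *], simp) (subst lift_pure[OF *], simp_all)
qed

lemma vector_space_scale: "vector_space scale" ..

lemmas multi_simps = bilin_def trilin_def vector_space_scale formal.vector_space_axioms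
  sw_add sw_fscale sw_scale distrib_left distrib_right scale_mult_left scale_mult_right antipode_add antipode_scale

definition act :: "'a \<Rightarrow> 'a \<Rightarrow> 'a" (infixl \<open>\<lhd>\<close> 70) where
  "x \<lhd> y = sw y (\<lambda>a b. antipode a * x * b)"

lemma act_simps: "(x + y) \<lhd> z = x \<lhd> z + y \<lhd> z" "(c *s x) \<lhd> z = c *s (x \<lhd> z)"
  "z \<lhd> (x + y) = z \<lhd> x + z \<lhd> y" "z \<lhd> (c *s x) = c *s (z \<lhd> x)"
proof -
  have b: "bilin scale (\<lambda>a b. antipode a * z * b)" by (simp add: multi_simps)
  show "z \<lhd> (x + y) = z \<lhd> x + z \<lhd> y" "z \<lhd> (c *s x) = c *s (z \<lhd> x)"
    by (simp_all add: act_def sw_arg_add[OF b] sw_arg_scale[OF b])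
qed (simp_all add: act_def multi_simps)

lemma ad: shows linear_on_ad: "linear_on 2 ad" and ad_pure: "ad (pure [x, y]) = pure [x \<lhd> y]"
proof -
  \<comment> \<open>The inner \<open>lift\<close> is evaluated for fixed arguments; only in the form
    \<open>z \<lhd> w\<close> is the outer function seen to be multilinear.\<close>
  have 1: "lift 2 (\<lambda>ys. pure [antipode (ys ! 0) * z * ys ! 1]) (comult w) = pure [z \<lhd> w]" for z w
  proof -
    have *: "multilinear 2 fscale (\<lambda>ys. emb (pure [antipode (ys ! 0) * z * ys ! 1]))"
      by (rule multilinear_2I) (simp_all add: pure_nth_add pure_nth_scale emb_tadd emb_tscale multi_simps)
    show ?thesis
      by (subst comult_tsw, subst linear_on_tsw[OF linear_on_lift[OF *]])
        (simp_all add: lift_pure[OF *, simplified] tsw_pure act_def)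
  qed
  have *: "multilinear 2 fscale (\<lambda>xs. emb (pure [xs ! 0 \<lhd> xs ! 1]))"
    by (rule multilinear_2I) (simp_all add: pure_nth_add pure_nth_scale emb_tadd emb_tscale act_simps)
  show "linear_on 2 ad" "ad (pure [x, y]) = pure [x \<lhd> y]"
    unfolding ad_def 1 by (rule linear_on_lift[OF *], simp) (subst lift_pure[OF *], simp_all)
qed

lemma linear_on_id: "linear_on n id"
  by (rule Hom_linear_on[OF Hom_id])

lemma linear_on_tens': "linear_on m f \<Longrightarrow> linear_on n g \<Longrightarrow> N = m + n \<Longrightarrow> linear_on N (f \<otimes>\<^bsub>m,n\<^esub> g)"
  by (simp add: linear_on_tens)

text \<open>The simplifier turns the degree \<open>1\<close> into \<open>Suc 0\<close>, hence the second copies.\<close>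

lemmas linear_on_maps = linear_on_id linear_on_tens' linear_on_mu linear_on_tau linear_on_Delta
  linear_on_Delta[unfolded One_nat_def] linear_on_eps linear_on_S linear_on_eps[unfolded One_nat_def]
  linear_on_S[unfolded One_nat_def] linear_on_ad

lemmas eval_pure = tens_pure tmul_pure mu_pure tau_pure Delta_pure eps_pure S_pure ad_pure

text \<open>Instances for the concrete maps: in the general rule the map is a variable and its
  degree occurs only in the premises.\<close>

lemmas eval_tsw = linear_on_tsw[OF linear_on_tens] linear_on_tsw[OF linear_on_mu]
  linear_on_tsw[OF linear_on_tau] linear_on_tsw[OF linear_on_Delta]
  linear_on_tsw[OF linear_on_ad] tmul_tsw

lemmas eval_tdiff = linear_on_tdiff[OF linear_on_tens] linear_on_tdiff[OF linear_on_mu]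
  linear_on_tdiff[OF linear_on_tau] linear_on_tdiff[OF linear_on_Delta]
  linear_on_tdiff[OF linear_on_ad]

text \<open>The axiom is an equation between tensors of degree 3. Since \<open>F\<close> factors
  through \<open>pt\<close>, applying \<open>h\<close> to both sides gives the equation for
  \<open>F\<close>.\<close>

lemma sw_coassoc:
  assumes "trilin s F"
  shows "sw x (\<lambda>a b. sw a (\<lambda>c d. F c d b)) = sw x (\<lambda>a b. sw b (\<lambda>c d. F a c d))"
proof -
  obtain h where h: "Vector_Spaces.linear fscale s h" "\<And>a b c. F a b c = h (pt [a, b, c])"
    using trilin_factors_pt[OF assms] by blast
  have "tsw x (\<lambda>a b. tsw a (\<lambda>c d. pure [c, d, b])) = tsw x (\<lambda>a b. tsw b (\<lambda>c d. pure [a, c, d]))"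
    using coassoc[of x] by (simp add: comult_tsw eval_pure eval_tsw linear_on_maps)
  from arg_cong[OF this, of "\<lambda>u. h (emb u)"] show ?thesis
    by (simp add: emb_tsw sw_linear[OF h(1)] h(2) pt_def)
qed

lemma sw_times:
  assumes "bilin s F"
  shows "sw (x * y) F = sw x (\<lambda>a b. sw y (\<lambda>c d. F (a * c) (b * d)))"
proof -
  obtain h where h: "Vector_Spaces.linear fscale s h" "\<And>a b. F a b = h (pt [a, b])"
    using bilin_factors_pt[OF assms] by blast
  have F: "F = (\<lambda>a b. h (pt [a, b]))" using h(2) by auto
  have "tsw (x * y) (\<lambda>a b. pure [a, b]) = tsw y (\<lambda>c d. tsw x (\<lambda>a b. pure [a * c, b * d]))"
    using comult_mult[of x y] by (simp add: comult_tsw eval_pure eval_tsw linear_on_maps)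
  from arg_cong[OF this, of "\<lambda>u. h (emb u)"] show ?thesis
    by (simp add: emb_tsw sw_linear[OF h(1)] F pt_def sw_swap[of x y])
qed

lemma sw_counit: "sw x (\<lambda>a b. counit a *s b) = x" "sw x (\<lambda>a b. counit b *s a) = x"
  using counit_left[of x] counit_right[of x]
  by (simp_all add: comult_tsw eval_pure eval_tsw linear_on_maps tmul_tscale_left tmul_tscale_right
      tsw_pure flip: pure_nth_scale)

lemma sw_antipode: "sw x (\<lambda>a b. antipode a * b) = counit x *s 1" "sw x (\<lambda>a b. a * antipode b) = counit x *s 1"
  using antipode_left[of x] antipode_right[of x]
  by (simp_all add: comult_tsw eval_pure eval_tsw linear_on_maps tsw_pure)

text \<open>The degree is a variable constrained by a premise so that the rules also resolve against
  unevaluated degrees such as \<open>1 + 1\<close>, which arise from \<open>Hom_tens\<close>.\<close>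

lemma Hom_tau: "n = 2 \<Longrightarrow> \<tau> \<in> Hom n 2"
  by (hypsubst, rule HomI[OF linear_on_tau]) (auto simp: tau_pure length_Suc_conv numeral_2_eq_2)

lemma Hom_mu: "n = 2 \<Longrightarrow> \<mu> \<in> Hom n 1"
  by (hypsubst, rule HomI[OF linear_on_mu]) (auto simp: mu_pure length_Suc_conv numeral_2_eq_2)

lemma Hom_ad: "n = 2 \<Longrightarrow> ad \<in> Hom n 1"
  by (hypsubst, rule HomI[OF linear_on_ad]) (auto simp: ad_pure length_Suc_conv numeral_2_eq_2)

lemma Hom_Delta: "n = 1 \<Longrightarrow> \<Delta> \<in> Hom n 2"
  by (hypsubst, rule HomI[OF linear_on_Delta]) (auto simp: Delta_pure length_Suc_conv)

lemmas Hom_maps = Hom_id Hom_tens Hom_hdiff Hom_hadd Hom_comp Hom_tau Hom_mu Hom_ad Hom_Delta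

text \<open>The simplification set that proves bilinearity and trilinearity of nested Sweedler sums.
  The scalar multiplication is instantiated since the conclusion of \<open>sw_arg_add\<close> does
  not determine it.\<close>

lemmas multi = multi_simps pt_add pt_scale act_simps
  sw_arg_add[where s = fscale] sw_arg_scale[where s = fscale]
  sw_arg_add[where s = scale] sw_arg_scale[where s = scale]

section \<open>Antipode and adjoint action\<close>

lemma sw_one:
  assumes "bilin s F"
  shows "sw 1 F = F 1 1"
proof -
  obtain h where h: "Vector_Spaces.linear fscale s h" "\<And>a b. F a b = h (pt [a, b])"
    using bilin_factors_pt[OF assms] by blast
  have F: "F = (\<lambda>a b. h (pt [a, b]))" using h(2) by auto
  from arg_cong[OF comult_one, of "\<lambda>u. h (emb u)"] show ?thesis
    by (simp add: comult_tsw emb_tsw sw_linear[OF h(1)] F pt_def)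
qed

lemma linear_sw: "bilin s F \<Longrightarrow> Vector_Spaces.linear scale s (\<lambda>x. sw x F)"
  unfolding Vector_Spaces.linear_iff
  by (simp add: sw_arg_add sw_arg_scale vector_space_scale) (simp add: bilin_def)

lemma sw_arg_sw: "bilin s F \<Longrightarrow> sw (sw y G) F = sw y (\<lambda>a b. sw (G a b) F)"
  by (rule sw_linear[OF linear_sw])

lemma linear_counit:
  assumes "Vector_Spaces.linear scale s h"
  shows "sw x (\<lambda>a b. s (counit a) (h b)) = h x" "sw x (\<lambda>a b. s (counit b) (h a)) = h x"
  using arg_cong[OF sw_counit(1), of h x] arg_cong[OF sw_counit(2), of h x]
  by (simp_all add: sw_linear[OF assms] lin_scale[OF assms])

lemma sw_swap3:
  "sw x (\<lambda>a b. sw y (\<lambda>c d. sw c (\<lambda>e g. F a b d e g))) = sw y (\<lambda>c d. sw c (\<lambda>e g. sw x (\<lambda>a b. F a b d e g)))"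
  by (subst sw_swap) (simp only: sw_swap[of x])

text \<open>Both sides are convolution inverses of the multiplication. Concretely,
  \<open>S(y1) S(x1) x2 y2 S(x3 y3)\<close> is contracted in two ways: on the right it leaves
  \<open>S(y) S(x)\<close>, on the left \<open>S(x y)\<close>.\<close>

lemma antipode_times: "antipode (x * y) = antipode y * antipode x"
proof -
  \<comment> \<open>The components of \<open>x\<close> are \<open>a\<close>, \<open>c\<close>,
    \<open>d\<close> and those of \<open>y\<close> are \<open>e\<close>, \<open>h\<close>,
    \<open>i\<close>, in this order.\<close>
  define F where "F = (\<lambda>a c d e h i. antipode e * antipode a * c * h * antipode (d * i))"
  have T1: "trilin scale (\<lambda>a c d. sw y (\<lambda>e g. sw g (\<lambda>h i. F a c d e h i)))"
    by (simp add: multi F_def)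
  have T2: "trilin scale (\<lambda>e h i. F a c d e h i)" for a c d
    by (simp add: multi F_def)
  have c1: "sw y (\<lambda>e g. counit g *s antipode e) = antipode y" for y
    by (rule linear_counit(2)[OF antipode_linear])
  have c2: "sw y (\<lambda>e g. counit e *s g) = y" for y
    by (rule sw_counit)
  have "antipode y * antipode x = sw x (\<lambda>a b. sw y (\<lambda>e g. (counit g *s antipode e) * (counit b *s antipode a)))"
    by (simp only: sw_mult c1)
  also have "\<dots> = sw x (\<lambda>a b. sw y (\<lambda>e g. antipode e * antipode a * sw (b * g) (\<lambda>u v. u * antipode v)))"
    by (simp add: sw_antipode counit_mult scale_mult_left scale_mult_right mult.commute)
  also have "\<dots> = sw x (\<lambda>a b. sw y (\<lambda>e g. sw b (\<lambda>c d. sw g (\<lambda>h i. F a c d e h i))))"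
    by (subst sw_times[of scale]) (simp_all add: multi F_def mult.assoc flip: sw_mult)
  also have "\<dots> = sw x (\<lambda>a b. sw b (\<lambda>c d. sw y (\<lambda>e g. sw g (\<lambda>h i. F a c d e h i))))"
    by (simp only: sw_swap[of y])
  also have "\<dots> = sw x (\<lambda>a b. sw a (\<lambda>a c. sw y (\<lambda>e g. sw g (\<lambda>h i. F a c b e h i))))"
    by (rule sw_coassoc[OF T1, symmetric])
  also have "\<dots> = sw x (\<lambda>a b. sw a (\<lambda>a c. sw y (\<lambda>e g. sw e (\<lambda>e h. F a c b e h g))))"
    by (simp only: sw_coassoc[OF T2])
  also have "\<dots> = sw x (\<lambda>a b. sw y (\<lambda>e g. sw e (\<lambda>e h. sw a (\<lambda>a c. F a c b e h g))))"
    by (simp only: sw_swap3[where F = "\<lambda>a c g e h. F a c _ e h g"])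
  \<comment> \<open>The product \<open>S(x1) x2\<close> becomes a counit first; this brings
    \<open>S(y1)\<close> and \<open>y2\<close> together, which then contract as well.\<close>
  also have "\<dots> = sw x (\<lambda>a b. sw y (\<lambda>e g. counit a *s counit e *s antipode (b * g)))"
  proof -
    have "sw a (\<lambda>a c. F a c b e h g) = antipode e * sw a (\<lambda>a c. antipode a * c) * (h * antipode (b * g))" for a b e h g
      by (simp add: F_def mult.assoc flip: sw_mult)
    then have 1: "sw a (\<lambda>a c. F a c b e h g) = counit a *s ((antipode e * h) * antipode (b * g))" for a b e h g
      by (simp add: sw_antipode scale_mult_left scale_mult_right mult.assoc)
    have "sw e (\<lambda>e h. sw a (\<lambda>a c. F a c b e h g)) = counit a *s counit e *s antipode (b * g)" for a b e g
      by (simp only: 1 sw_scale sw_mult sw_antipode) (simp add: scale_mult_left)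
    then show ?thesis by simp
  qed
  also have "\<dots> = antipode (sw x (\<lambda>a b. sw y (\<lambda>e g. (counit a *s b) * (counit e *s g))))"
    by (simp add: sw_linear[OF antipode_linear] antipode_scale scale_mult_left scale_mult_right mult.commute)
  also have "\<dots> = antipode (x * y)"
    by (simp only: sw_mult c2)
  finally show ?thesis ..
qed

text \<open>Inserting \<open>S z\<^sub>1 z\<^sub>2 = \<epsilon> z\<^sub>1\<close> turns \<open>(1 \<otimes> z\<^sub>1) \<Delta> (S z\<^sub>2)\<close> into \<open>(S z\<^sub>1 \<otimes> 1) \<Delta> (z\<^sub>2 S z\<^sub>3)\<close>, which is
  \<open>S z \<otimes> 1\<close>; this avoids the anticomultiplicativity of \<open>S\<close>.\<close>

lemma comult_antipode:
  assumes "bilin fscale G"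
  shows "sw z (\<lambda>a b. sw (antipode b) (\<lambda>c d. G c (a * d))) = G (antipode z) 1"
proof -
  note [simp] = bilin_simps[OF assms]
  \<comment> \<open>\<open>M\<close> is the summand for four consecutive components of
    \<open>z\<close>. In \<open>N\<close> the middle two are regrouped as the components of one
    factor \<open>r\<close>, which the second use of coassociativity needs.\<close>
  define M where "M z1 z2 z3 z4 = sw (antipode z4) (\<lambda>c d. G (antipode z1 * z2 * c) (z3 * d))" for z1 z2 z3 z4
  define N where "N z1 r b = sw r (\<lambda>z2 q. M z1 z2 q b)" for z1 r b
  have M: "trilin fscale (\<lambda>z1 z2 q. M z1 z2 q b)" for b
    by (simp add: multi M_def)
  have N: "trilin fscale N"
    by (simp add: multi M_def N_def)
  have 1: "sw p (\<lambda>z1 z2. G (antipode z1 * z2 * c) q) = fscale (counit p) (G c q)" for p c q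
  proof -
    have "Vector_Spaces.linear scale fscale (\<lambda>u. G (u * c) q)"
      by (simp add: Vector_Spaces.linear_iff multi)
    from sw_linear[OF this, of p "\<lambda>a b. antipode a * b"] show ?thesis
      by (simp add: sw_antipode multi)
  qed
  \<comment> \<open>Here \<open>a\<close> is written as \<open>counit p *s q\<close> summed over its
    components, and the counit is expanded into \<open>S(z1) z2\<close>.\<close>
  have 2: "G c (a * d) = sw a (\<lambda>p q. sw p (\<lambda>z1 z2. G (antipode z1 * z2 * c) (q * d)))" for a c d
  proof -
    have "Vector_Spaces.linear scale fscale (\<lambda>u. G c (u * d))"
      by (simp add: Vector_Spaces.linear_iff multi)
    from linear_counit(1)[OF this, of a] show ?thesis by (simp add: 1)
  qed
  \<comment> \<open>Multiplicativity merges the components of \<open>q\<close> and of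
    \<open>S(z4)\<close> into those of \<open>q * antipode z4\<close>; summed over \<open>r\<close>
    this product is a multiple of 1, whose comultiplication is known.\<close>
  have 3: "sw r (\<lambda>q z4. sw q (\<lambda>z2 z3. M z1 z2 z3 z4)) = fscale (counit r) (G (antipode z1) 1)" for z1 r
  proof -
    have B: "bilin fscale (\<lambda>u v. G (antipode z1 * u) v)" by (simp add: multi)
    have "sw q (\<lambda>z2 z3. M z1 z2 z3 z4) = sw (q * antipode z4) (\<lambda>u v. G (antipode z1 * u) v)" for q z4
      by (simp add: sw_times[OF B] M_def mult.assoc)
    then have "sw r (\<lambda>q z4. sw q (\<lambda>z2 z3. M z1 z2 z3 z4))
        = sw (sw r (\<lambda>q z4. q * antipode z4)) (\<lambda>u v. G (antipode z1 * u) v)"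
      by (simp add: sw_arg_sw[OF B])
    also have "\<dots> = fscale (counit r) (G (antipode z1) 1)"
      by (simp add: sw_antipode sw_arg_scale[OF B] sw_one[OF B])
    finally show ?thesis .
  qed
  have "sw z (\<lambda>a b. sw (antipode b) (\<lambda>c d. G c (a * d))) =
      sw z (\<lambda>a b. sw (antipode b) (\<lambda>c d. sw a (\<lambda>p q. sw p (\<lambda>z1 z2. G (antipode z1 * z2 * c) (q * d)))))"
    by (simp flip: 2)
  also have "\<dots> = sw z (\<lambda>a b. sw a (\<lambda>p q. sw p (\<lambda>z1 z2. M z1 z2 q b)))"
    unfolding M_def by (simp only: sw_swap[of "antipode _"])
  also have "\<dots> = sw z (\<lambda>a b. sw a (\<lambda>z1 r. N z1 r b))"
    by (simp only: sw_coassoc[OF M] N_def)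
  also have "\<dots> = sw z (\<lambda>z1 t. sw t (\<lambda>r b. N z1 r b))"
    by (rule sw_coassoc[OF N])
  also have "\<dots> = sw z (\<lambda>z1 t. fscale (counit t) (G (antipode z1) 1))"
    by (simp only: 3 N_def)
  also have "\<dots> = G (antipode z) 1"
  proof (rule linear_counit(2))
    show "Vector_Spaces.linear scale fscale (\<lambda>u. G (antipode u) 1)"
      by (simp add: Vector_Spaces.linear_iff multi)
  qed
  finally show ?thesis .
qed

text \<open>The Yetter-Drinfeld compatibility. The factor \<open>a\<close> on the left of the second
  slot meets the comultiplication of \<open>S(e)\<close>, where \<open>comult_antipode\<close>
  absorbs it; what remains is the adjoint action in the first slot alone.\<close>

lemma comult_act:
  assumes "bilin fscale G"
  shows "sw z (\<lambda>a b. sw (p \<lhd> b) (\<lambda>c d. G c (a * d))) = sw z (\<lambda>a b. sw p (\<lambda>c d. G (c \<lhd> a) (d * b)))"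
proof -
  note [simp] = bilin_simps[OF assms]
  have B: "bilin fscale (\<lambda>c d. G c (a * d))" for a by (simp add: multi)
  have "sw z (\<lambda>a b. sw (p \<lhd> b) (\<lambda>c d. G c (a * d))) =
      sw z (\<lambda>a b. sw b (\<lambda>e g. sw (antipode e * p * g) (\<lambda>c d. G c (a * d))))"
    by (simp add: act_def sw_arg_sw[OF B])
  \<comment> \<open>Coassociativity makes \<open>a\<close> and \<open>e\<close> the two components
    of one element \<open>w\<close>, as \<open>comult_antipode\<close> requires.\<close>
  also have "\<dots> = sw z (\<lambda>w g. sw w (\<lambda>a e. sw (antipode e * p * g) (\<lambda>c d. G c (a * d))))"
    by (rule sw_coassoc[where s = fscale, symmetric]) (simp add: multi)
  also have "\<dots> = sw z (\<lambda>w g. sw w (\<lambda>a e. sw (antipode e) (\<lambda>s t. sw (p * g) (\<lambda>c d. G (s * c) (a * t * d)))))"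
    by (simp add: sw_times[OF B] mult.assoc)
  also have "\<dots> = sw z (\<lambda>w g. sw (p * g) (\<lambda>c d. G (antipode w * c) d))"
  proof -
    have "bilin fscale (\<lambda>s v. sw (p * g) (\<lambda>c d. G (s * c) (v * d)))" for g by (simp add: multi)
    from comult_antipode[OF this] show ?thesis by simp
  qed
  also have "\<dots> = sw z (\<lambda>w g. sw p (\<lambda>c d. sw g (\<lambda>m n. G (antipode w * c * m) (d * n))))"
    by (subst sw_times[of fscale]) (simp_all add: multi mult.assoc)
  also have "\<dots> = sw z (\<lambda>w g. sw g (\<lambda>m n. sw p (\<lambda>c d. G (antipode w * c * m) (d * n))))"
    by (simp only: sw_swap[of p])
  also have "\<dots> = sw z (\<lambda>a b. sw a (\<lambda>w m. sw p (\<lambda>c d. G (antipode w * c * m) (d * b))))"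
    by (rule sw_coassoc[where s = fscale, symmetric]) (simp add: multi)
  also have "\<dots> = sw z (\<lambda>a b. sw p (\<lambda>c d. sw a (\<lambda>w m. G (antipode w * c * m) (d * b))))"
    by (simp only: sw_swap[of p])
  also have "\<dots> = sw z (\<lambda>a b. sw p (\<lambda>c d. G (c \<lhd> a) (d * b)))"
  proof -
    have "Vector_Spaces.linear scale fscale (\<lambda>u. G u v)" for v
      by (simp add: Vector_Spaces.linear_iff multi)
    from sw_linear[OF this] show ?thesis by (simp add: act_def)
  qed
  finally show ?thesis .
qed

lemma act_times: "x \<lhd> (y * z) = (x \<lhd> y) \<lhd> z"
proof -
  have "x \<lhd> (y * z) = sw y (\<lambda>a b. sw z (\<lambda>c d. antipode c * (antipode a * (x * (b * d)))))"
    unfolding act_def by (subst sw_times[of scale]) (simp_all add: multi antipode_times mult.assoc)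
  also have "\<dots> = sw z (\<lambda>c d. sw y (\<lambda>a b. antipode c * (antipode a * (x * (b * d)))))"
    by (rule sw_swap)
  also have "\<dots> = (x \<lhd> y) \<lhd> z"
    by (simp add: act_def mult.assoc flip: sw_mult)
  finally show ?thesis .
qed

lemma act_diff: "(x - y) \<lhd> z = x \<lhd> z - y \<lhd> z"
  using act_simps(1)[of "x - y" y z] by simp

lemma sw_arg_diff: "bilin fscale F \<Longrightarrow> sw (x - y) F = sw x F - sw y F"
  using sw_arg_add[of fscale F "x - y" y] by simp

lemma Hom_R_ad: "n = 2 \<Longrightarrow> R_ad \<in> Hom n 2"
  unfolding R_ad_def
  by (rule Hom_maps refl | simp)+

lemma R_ad_pure: "R_ad (pure [x, y]) = tsw y (\<lambda>a b. pure [a, x \<lhd> b])"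
  by (simp add: R_ad_def eval_pure eval_tsw linear_on_maps)

lemmas eval_R_ad = R_ad_pure linear_on_tsw[OF Hom_linear_on[OF Hom_R_ad[OF refl]]]
  Hom_linear_on[OF Hom_R_ad[OF refl]]

lemmas emb_simps = emb_tdiff emb_tadd emb_tsw pt_def[symmetric]

section \<open>The differentials of a 2-cochain\<close>

context
  fixes \<phi> and f
  assumes phi: "\<phi> \<in> Hom 2 1" and phi_pure: "\<And>x y. \<phi> (pure [x, y]) = pure [f x y]"
begin

lemma Hom_phi: "n = 2 \<Longrightarrow> \<phi> \<in> Hom n 1"
  using phi by simp

lemma linear_on_phi: "linear_on 2 \<phi>"
  by (rule Hom_linear_on[OF phi])

lemmas eval_phi = phi_pure linear_on_phi linear_on_tsw[OF linear_on_phi]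

lemma Hom_d21: "n = 3 \<Longrightarrow> d21 \<phi> \<in> Hom n 1"
  unfolding d21_def
  by (rule Hom_maps Hom_phi refl | simp)+

lemma d21_pure: "d21 \<phi> (pure [x, y, z]) = pure [f x y \<lhd> z + f (x \<lhd> y) z - f x (y * z)]"
  by (simp add: d21_def hadd_def hdiff_def eval_pure eval_tsw eval_phi linear_on_maps
      tadd_pure tdiff_pure)

lemma Hom_d22: "n = 2 \<Longrightarrow> d22 \<phi> \<in> Hom n 2"
  unfolding d22_def
  by (rule Hom_maps Hom_phi refl | simp)+

lemma d22_pure: "d22 \<phi> (pure [x, y]) =
    tdiff (tsw y (\<lambda>c d. tsw x (\<lambda>a b. pure [f a c, b * d])))
      (tsw y (\<lambda>a b. tsw (f x b) (\<lambda>c d. pure [c, a * d])))"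
  by (simp add: d22_def hdiff_def eval_pure eval_tsw eval_phi linear_on_maps)

lemmas linear_on_d21 = Hom_linear_on[OF Hom_d21[OF refl]]
lemmas linear_on_d22 = Hom_linear_on[OF Hom_d22[OF refl]]
lemmas eval_d = d21_pure d22_pure linear_on_d21 linear_on_d22
  linear_on_tsw[OF linear_on_d21] linear_on_tsw[OF linear_on_d22]

text \<open>Linearity of \<open>\<phi>\<close> passes to \<open>f\<close> because
  \<open>pure [x]\<close> determines \<open>x\<close>.\<close>

lemma f_simps:
  "f (x + y) z = f x z + f y z" "f z (x + y) = f z x + f z y"
  "f (c *s x) z = c *s f x z" "f z (c *s x) = c *s f z x"
proof -
  note [simp] = linear_on_tadd[OF linear_on_phi] linear_on_tscale[OF linear_on_phi]
  have "pure [f (x + y) z] = pure [f x z + f y z]" "pure [f z (x + y)] = pure [f z x + f z y]"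
    "pure [f (c *s x) z] = pure [c *s f x z]" "pure [f z (c *s x)] = pure [c *s f z x]"
    unfolding phi_pure[symmetric] pure_nth_add pure_nth_scale by simp_all
  then show "f (x + y) z = f x z + f y z" "f z (x + y) = f z x + f z y"
    "f (c *s x) z = c *s f x z" "f z (c *s x) = c *s f z x" by simp_all
qed

text \<open>Membership in \<open>Hom\<close> gives linearity, so that vanishing on elementary
  tensors suffices; for the other two components it also shows that values are cosets, on which
  \<open>emb\<close> is injective.\<close>

lemma Hom_d31: "d31 (d21 \<phi>) (d22 \<phi>) \<in> Hom 4 1"
  unfolding d31_def
  by (rule Hom_maps Hom_phi Hom_d21 Hom_d22 refl | simp)+

lemma Hom_d32: "d32 (d21 \<phi>) (d22 \<phi>) \<in> Hom 3 2"
  unfolding d32_def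
  by (rule Hom_maps Hom_phi Hom_d21 Hom_d22 Hom_R_ad refl | simp)+

lemma Hom_d33: "d33 (d21 \<phi>) (d22 \<phi>) \<in> Hom 2 3"
  unfolding d33_def
  by (rule Hom_maps Hom_phi Hom_d21 Hom_d22 Hom_R_ad refl | simp)+

section \<open>Vanishing of the three components\<close>

lemmas all_evals = hadd_def hdiff_def eval_pure eval_tsw eval_tdiff eval_phi eval_d linear_on_maps
  tadd_pure tdiff_pure eval_R_ad tsw_tdiff tmul_tdiff_left tmul_tdiff_right

text \<open>Up to sign, \<open>d21\<close> and \<open>d31\<close> are the Hochschild coboundaries of
  H with coefficients in the endomorphisms of its right adjoint module, the first argument being the
  module element. Associativity and \<open>act_times\<close> are thus all that the cancellation
  needs.\<close>

lemma d31_pure: "d31 (d21 \<phi>) (d22 \<phi>) (pure [x, y, z, w]) = tzero"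
  by (simp add: d31_def all_evals linear_on_tadd[OF linear_on_d21])
    (simp add: act_simps act_diff act_times pure_0 mult.assoc)

lemmas multi_f = multi f_simps

text \<open>Twelve terms form six cancelling pairs, one equation for each. \<open>E1\<close> and
  \<open>E4\<close> only reorder sums, \<open>E5\<close> and \<open>E6\<close> use multiplicativity
  of the comultiplication on \<open>y * z\<close>, and \<open>E2\<close> and \<open>E3\<close> are
  the two uses of \<open>comult_act\<close>.\<close>

lemma d32_pure: "d32 (d21 \<phi>) (d22 \<phi>) (pure [x, y, z]) = tzero"
proof -
  have E1: "sw y (\<lambda>a b. sw x (\<lambda>p q. sw z (\<lambda>c d. pt [f p a \<lhd> c, q * b * d]))) =
      sw z (\<lambda>c d. sw y (\<lambda>a b. sw x (\<lambda>p q. pt [f p a \<lhd> c, q * b * d])))"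
    by (simp only: sw_swap[of x z] sw_swap[of y z])
  have E2: "sw y (\<lambda>a b. sw z (\<lambda>c d. sw (x \<lhd> b) (\<lambda>p q. pt [f p c, a * (q * d)]))) =
      sw z (\<lambda>c d. sw y (\<lambda>a b. sw x (\<lambda>p q. pt [f (p \<lhd> a) c, q * b * d])))"
  proof -
    \<comment> \<open>The sum over \<open>z\<close> is made part of the bilinear function, so that
      \<open>comult_act\<close> sees only \<open>y\<close> acting on \<open>x\<close>.\<close>
    have "bilin fscale (\<lambda>u v. sw z (\<lambda>c d. pt [f u c, v * d]))" by (simp add: multi_f)
    from comult_act[OF this, of y x] show ?thesis
      by (simp only: mult.assoc sw_swap[of x z] sw_swap[of y z] sw_swap[of "x \<lhd> _" z])
  qed
  have E3: "sw z (\<lambda>c d. sw y (\<lambda>a b. sw (f x b \<lhd> d) (\<lambda>u v. pt [u, a * (c * v)]))) =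
      sw y (\<lambda>a b. sw (f x b) (\<lambda>u v. sw z (\<lambda>c d. pt [u \<lhd> c, a * v * d])))"
  proof -
    have "bilin fscale (\<lambda>u v. pt [u, a * v])" for a by (simp add: multi_f)
    from comult_act[OF this, of z] show ?thesis
      by (simp only: mult.assoc sw_swap[of z y] sw_swap[of "f x _" z])
  qed
  have E4: "sw z (\<lambda>c d. sw y (\<lambda>a b. sw (f (x \<lhd> b) d) (\<lambda>u v. pt [u, a * (c * v)]))) =
      sw y (\<lambda>a b. sw z (\<lambda>c d. sw (f (x \<lhd> b) d) (\<lambda>u v. pt [u, a * (c * v)])))"
    by (rule sw_swap)
  have E5: "sw (y * z) (\<lambda>a b. sw (f x b) (\<lambda>u v. pt [u, a * v])) =
      sw z (\<lambda>c d. sw y (\<lambda>a b. sw (f x (b * d)) (\<lambda>u v. pt [u, a * (c * v)])))"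
    by (subst sw_times[of fscale]) (simp_all add: multi_f mult.assoc sw_swap[of z y])
  have E6: "sw (y * z) (\<lambda>a b. sw x (\<lambda>p q. pt [f p a, q * b])) =
      sw z (\<lambda>c d. sw y (\<lambda>a b. sw x (\<lambda>p q. pt [f p (a * c), q * b * d])))"
    by (subst sw_times[of fscale]) (simp_all add: multi_f mult.assoc sw_swap[of z y])
  have "emb (d32 (d21 \<phi>) (d22 \<phi>) (pure [x, y, z])) = emb tzero"
    by (simp add: d32_def all_evals)
      (simp add: emb_simps emb_tzero multi_f pt_diff sw_arg_diff sw_diff
        E1 E2 E3 E4 E5 E6)
  then show ?thesis
    using T_range[OF Hom_T[OF Hom_d32, of "pure [x, y, z]"]] by (simp add: emb_inject)
qed

text \<open>Six terms form three pairs. \<open>E1\<close> needs coassociativity in \<open>y\<close>;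
  \<open>E2\<close> needs it in \<open>y\<close> and in the value of \<open>f\<close>,
  \<open>E3\<close> in \<open>x\<close> and \<open>y\<close>, and both also multiplicativity of the
  comultiplication.\<close>

lemma d33_pure: "d33 (d21 \<phi>) (d22 \<phi>) (pure [x, y]) = tzero"
proof -
  have E1: "sw y (\<lambda>a b. sw b (\<lambda>c d. sw x (\<lambda>p q. sw (f p c) (\<lambda>u v. pt [u, a * v, q * d])))) =
      sw y (\<lambda>a b. sw x (\<lambda>p q. sw a (\<lambda>c d. sw (f p d) (\<lambda>u v. pt [u, c * v, q * b]))))"
  proof -
    have "trilin fscale (\<lambda>a c d. sw x (\<lambda>p q. sw (f p c) (\<lambda>u v. pt [u, a * v, q * d])))"
      by (simp add: multi_f)
    from sw_coassoc[OF this, of y] show ?thesis by (simp only: sw_swap[of x])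
  qed
  have E2: "sw y (\<lambda>a b. sw (f x b) (\<lambda>c d. sw (a * d) (\<lambda>u v. pt [c, u, v]))) =
      sw y (\<lambda>a b. sw b (\<lambda>c d. sw (f x d) (\<lambda>p q. sw p (\<lambda>u v. pt [u, a * v, c * q]))))"
  proof -
    have 1: "trilin fscale (\<lambda>u v q. pt [u, a * v, c * q])" for a c
      by (simp add: multi_f)
    have 2: "trilin fscale (\<lambda>a c d. sw (f x d) (\<lambda>p q. sw q (\<lambda>u v. pt [p, a * u, c * v])))"
      by (simp add: multi_f)
    have "sw (a * d) (\<lambda>u v. pt [c, u, v]) = sw a (\<lambda>m n. sw d (\<lambda>u v. pt [c, m * u, n * v]))" for a c d
      by (subst sw_times[of fscale]) (simp_all add: multi_f)
    then show ?thesis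
      by (simp only: sw_coassoc[OF 1] sw_coassoc[OF 2, symmetric] sw_swap[of "f x _"])
  qed
  have E3: "sw y (\<lambda>a b. sw x (\<lambda>p q. sw (q * b) (\<lambda>u v. pt [f p a, u, v]))) =
      sw y (\<lambda>a b. sw x (\<lambda>p q. sw a (\<lambda>c d. sw p (\<lambda>r s. pt [f r c, s * d, q * b]))))"
  proof -
    have 1: "trilin fscale (\<lambda>r s q. pt [f r c, s * d, q * b])" for b c d
      by (simp add: multi_f)
    have 2: "trilin fscale (\<lambda>c d b. sw x (\<lambda>p q. sw p (\<lambda>r s. pt [f r c, s * d, q * b])))"
      by (simp add: multi_f)
    have 3: "sw (q * b) (\<lambda>u v. pt [w, u, v]) = sw b (\<lambda>m n. sw q (\<lambda>u v. pt [w, u * m, v * n]))" for q b w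
      by (subst sw_times[of fscale]) (simp_all add: multi_f sw_swap[of b q])
    have "sw y (\<lambda>a b. sw x (\<lambda>p q. sw (q * b) (\<lambda>u v. pt [f p a, u, v]))) =
      sw y (\<lambda>a b. sw b (\<lambda>c d. sw x (\<lambda>p q. sw p (\<lambda>r s. pt [f r a, s * c, q * d]))))"
      by (simp only: 3 sw_coassoc[OF 1] sw_swap[of x])
    also have "\<dots> = sw y (\<lambda>a b. sw a (\<lambda>c d. sw x (\<lambda>p q. sw p (\<lambda>r s. pt [f r c, s * d, q * b]))))"
      by (rule sw_coassoc[OF 2, symmetric])
    finally show ?thesis by (simp only: sw_swap[of x])
  qed
  have "emb (d33 (d21 \<phi>) (d22 \<phi>) (pure [x, y])) = emb tzero"
    by (simp add: d33_def all_evals) (simp add: emb_simps emb_tzero E1 E2 E3)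
  then show ?thesis
    using T_range[OF Hom_T[OF Hom_d33, of "pure [x, y]"]] by (simp add: emb_inject)
qed

theorem D3_D2:
  "case D3 (D2 \<phi>) of (\<eta>1, \<eta>2, \<eta>3) \<Rightarrow>
    (\<forall>u\<in>T 4. \<eta>1 u = tzero) \<and> (\<forall>u\<in>T 3. \<eta>2 u = tzero) \<and> (\<forall>u\<in>T 2. \<eta>3 u = tzero)"
proof -
  have "d31 (d21 \<phi>) (d22 \<phi>) u = tzero" if "u \<in> T 4" for u
    by (rule Hom_eq_tzero[OF Hom_d31 _ that]) (auto simp: length_Suc_conv eval_nat_numeral d31_pure)
  moreover have "d32 (d21 \<phi>) (d22 \<phi>) u = tzero" if "u \<in> T 3" for u
    by (rule Hom_eq_tzero[OF Hom_d32 _ that]) (auto simp: length_Suc_conv eval_nat_numeral d32_pure)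
  moreover have "d33 (d21 \<phi>) (d22 \<phi>) u = tzero" if "u \<in> T 2" for u
    by (rule Hom_eq_tzero[OF Hom_d33 _ that]) (auto simp: length_Suc_conv eval_nat_numeral d33_pure)
  ultimately show ?thesis by (simp add: D3_def D2_def)
qed

end

end

theorem theorem4p5:
  fixes scale :: "'k::field \<Rightarrow> 'a::ring_1 \<Rightarrow> 'a"
    and comult :: "'a \<Rightarrow> ('a, 'k) tensor"
    and counit :: "'a \<Rightarrow> 'k"
    and antipode :: "'a \<Rightarrow> 'a"
    and \<phi> :: "('a, 'k) tensor \<Rightarrow> ('a, 'k) tensor"
  assumes "hopf_algebra scale comult counit antipode"
    and "\<phi> \<in> tensor_powers.Hom scale 2 1"
  shows "case hopf_algebra.D3 scale comult antipode (hopf_algebra.D2 scale comult antipode \<phi>) of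
    (\<eta>1, \<eta>2, \<eta>3) \<Rightarrow>
      (\<forall>u\<in>tensor_powers.T scale 4. \<eta>1 u = tensor_powers.tzero scale) \<and>
      (\<forall>u\<in>tensor_powers.T scale 3. \<eta>2 u = tensor_powers.tzero scale) \<and>
      (\<forall>u\<in>tensor_powers.T scale 2. \<eta>3 u = tensor_powers.tzero scale)"
proof -
  interpret hopf_algebra scale comult counit antipode by fact
  \<comment> \<open>The values of \<open>\<phi>\<close> have degree 1, so \<open>hval\<close> reads
    them as elements of H; this supplies the function \<open>f\<close> of the calculation.\<close>
  have "\<phi> (pure [x, y]) = pure [hval (\<phi> (pure [x, y]))]" for x y
    by (rule pure_hval[symmetric], rule Hom_T[OF assms(2)]) simp
  from D3_D2[OF assms(2) this] show ?thesis .
qed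

end
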